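(* Let $a\in\mathbf{R}$, $\tau^*>0$, $L\ge 0$, and let $f\in L^2(\mathbf{R})$ satisfy $\operatorname{supp} f\subset[-L,\infty)$. Suppose that $$\int_0^{\tau^*}\big(U_a(\tau^*-s)[\,w(s,\cdot)f(\cdot)\,]\big)(y)\,ds=0\quad\text{for (almost) every } y\in\mathbf{R}.$$ Then $f=0$ almost everywhere on $\mathbf{R}$. Equivalently, a solution $f$ of the integral equation $v(\tau^*,y)=\int_0^{\tau^*}U_a(\tau^*-s)[w(s,\cdot)f(\cdot)](y)\,ds$ with given left-hand side is unique.
   Context: Fix $a\in\mathbf{R}$ (in the paper's application $a=\frac{\sigma_0^2-2\mu_0}{2\sigma_0^2}-1$ for a constant volatility $\sigma_0>0$ and constant drift $\mu_0$, but $a$ is an arbitrary real constant here). For $\tau>0$ and $y\in\mathbf{R}$ let $K_a(\tau,y)=\frac{1}{\sqrt{4\pi\tau}}\exp\!\big(-\frac{|y|^2}{4\tau}+ay\big)$, and define the operator $(U_a(\tau)\varphi)(y)=\int_{\mathbf{R}}K_a(\tau,y-x)\varphi(x)\,dx$. Define $w(\tau,x)=\int_0^\infty K_a(\tau,x-y)\,dy$ for $\tau>0$, $x\in\mathbf{R}$ (equivalently $w(\tau,x)=\pi^{-1/2}e^{\tau a^2}\int_{-\infty}^{(x-2\tau a)/\sqrt{4\tau}}e^{-\theta^2}d\theta$); $w$ is the solution of $(\partial_\tau+H_a)w=0$, $w(0,\cdot)=1_{[0,\infty)}$, where $H_a=-(\frac{d}{dy}-a)^2$. The integral $\int_0^{\tau^*}U_a(\tau^*-s)[w(s,\cdot)f]\,ds$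 is the value at time $\tau^*$ of the solution $v$ of $(\partial_\tau+H_a)v=f(y)w(\tau,y)$, $v(0,\cdot)=0$; this is the linearized inverse problem of recovering the drift perturbation $f$ from $v(\tau^*,\cdot)$. *)

theory Defs
  imports "HOL-Analysis.Analysis"
begin

definition K :: "real \<Rightarrow> real \<Rightarrow> real \<Rightarrow> real" where
  "K a \<tau> y = exp (- (\<bar>y\<bar>\<^sup>2) / (4 * \<tau>) + a * y) / sqrt (4 * pi * \<tau>)"

definition U :: "real \<Rightarrow> real \<Rightarrow> (real \<Rightarrow> real) \<Rightarrow> real \<Rightarrow> real" where
  "U a \<tau> \<phi> y = (\<integral>x. K a \<tau> (y - x) * \<phi> x \<partial>lborel)"

definition w :: "real \<Rightarrow> real \<Rightarrow> real \<Rightarrow> real" where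
  "w a \<tau> x = (\<integral>y\<in>{0..}. K a \<tau> (x - y) \<partial>lborel)"

end

theory Submission
  imports Defs "HOL-Probability.Probability" "HOL-Real_Asymp.Real_Asymp"
begin

text \<open>
  After the exponential factors are split off, the time integral of the two heat kernels is explicit:
  \<open>\<integral>\<^sub>0\<^sup>t G\<^sub>t\<^sub>-\<^sub>s(A) G\<^sub>s(B) ds = 1/2 \<integral>\<^sub>c\<^sub>>\<^sub>A\<^sub>+\<^sub>B G\<^sub>t(c) dc\<close> for \<open>A, B > 0\<close>.
  With \<open>A = |y - x|\<close> and \<open>B = |x - z|\<close>, the set of \<open>x\<close> with \<open>A + B < c\<close> is an interval, so \<open>f\<close> enters only
  through \<open>\<Phi>(t) = \<integral>\<^sub>x\<^sub>\<le>\<^sub>t f\<close>. For \<open>y < -L\<close> the hypothesis becomes a Gaussian convolution of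
  \<open>M(u) = \<integral>\<^sub>0\<^sup>u e\<^sup>-\<^sup>a\<^sup>z \<Phi>((z + u)/2) dz = 2 e\<^sup>a\<^sup>u (R(u) - R(u/2))\<close>, where \<open>R'(s) = e\<^sup>-\<^sup>2\<^sup>a\<^sup>s \<Phi>(s)\<close>.
  A Gaussian convolution of a function on a half-line that vanishes on a half-line is a vanishing
  Laplace transform, so \<open>M = 0\<close>; then \<open>R(u) = R(u/2) = R(u/4) = \<dots> = R(0)\<close> and \<open>\<Phi> = 0\<close> on \<open>[0, \<infinity>)\<close>.
  With this, the values \<open>y > 0\<close> give in the same way \<open>R(-u/2) = R(0)\<close> for \<open>u \<ge> 0\<close>, so \<open>\<Phi> = 0\<close> everywhere.
\<close>

section \<open>The bridge integral of the heat kernel\<close>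

text \<open>The kernel with the drift factor removed: for \<open>t > 0\<close> the centred Gaussian
  density of variance \<open>2 * t\<close>. At \<open>t = 0\<close> division by zero makes it
  0.\<close>

definition heat :: "real \<Rightarrow> real \<Rightarrow> real" where
  "heat t x = exp (- x\<^sup>2 / (4 * t)) / sqrt (4 * pi * t)"

lemma K_eq_heat: "K a t x = exp (a * x) * heat t x"
  unfolding K_def heat_def exp_add by simp

lemma heat_nonneg [simp]: "0 \<le> t \<Longrightarrow> 0 \<le> heat t x"
  by (simp add: heat_def)

lemma heat_abs [simp]: "heat t \<bar>x\<bar> = heat t x"
  by (simp add: heat_def)

lemma borel_measurable_heat [measurable]:
  assumes [measurable]: "f \<in> borel_measurable M" "g \<in> borel_measurable M"
  shows "(\<lambda>x. heat (f x) (g x)) \<in> borel_measurable M"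
  unfolding heat_def by measurable

lemma continuous_heat: "isCont (heat t) x"
  unfolding heat_def divide_inverse by (intro continuous_intros)

lemma heat_eq_normal_density:
  assumes "0 < t"
  shows "heat t = normal_density 0 (sqrt (2 * t))"
  using assms by (simp add: fun_eq_iff heat_def normal_density_def field_simps)

text \<open>The primitive is the normal cdf, whose limits are known. Continuity gives some
  antiderivative \<open>F\<close>; by the fundamental theorem the cdf has the same increments, so it
  differs from \<open>F\<close> by a constant and inherits the derivative.\<close>

lemma heat_primitive:
  assumes t: "0 < t"
  obtains E where "\<And>x. (E has_real_derivative heat t x) (at x)"
    "(E \<longlongrightarrow> 1) at_top" "(E \<longlongrightarrow> 0) at_bot"
proof -
  define M where "M = density lborel (heat t)"
  interpret M: prob_space M
    unfolding M_def heat_eq_normal_density[OF t] by (rule prob_space_normal_density) (use t in simp)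
  interpret M: real_distribution M
    by standard (simp_all add: M_def)
  obtain F where F: "\<And>x. (F has_real_derivative heat t x) (at x)"
    using einterval_antiderivative[of "-\<infinity>" \<infinity> "heat t"] continuous_heat
    by (auto simp: has_real_derivative_iff_has_vector_derivative)
  have diff: "cdf M y - cdf M x = F y - F x" if "x < y" for x y
  proof -
    have "ennreal (measure M {x<..y}) = (\<integral>\<^sup>+z. ennreal (heat t z) * indicator {x<..y} z \<partial>lborel)"
      unfolding M.emeasure_eq_measure[symmetric] by (simp add: M_def emeasure_density)
    also have "\<dots> = (\<integral>\<^sup>+z. ennreal (heat t z) * indicator {x..y} z \<partial>lborel)"
      by (rule nn_integral_cong_AE) (use AE_lborel_singleton[of x] in \<open>auto simp: indicator_def\<close>)
    also have "\<dots> = ennreal (F y - F x)"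
      by (rule nn_integral_FTC_Icc) (use F that t in \<open>auto intro: has_field_derivative_at_within
        simp flip: has_real_derivative_iff_has_vector_derivative\<close>)
    moreover have "F x \<le> F y"
      using DERIV_nonneg_imp_nondecreasing[of x y F] F that t heat_nonneg by (metis less_imp_le)
    ultimately show ?thesis
      using M.cdf_diff_eq[OF that] by simp
  qed
  have eq: "cdf M x = F x + (cdf M 0 - F 0)" for x
    using diff[of x 0] diff[of 0 x] by (cases "x = 0"; cases "x < 0") auto
  show ?thesis
  proof
    show "(cdf M has_real_derivative heat t x) (at x)" for x
      using DERIV_add[OF F DERIV_const, of "cdf M 0 - F 0" x] by (simp flip: eq)
  qed (fact M.cdf_lim_at_top_prob M.cdf_lim_at_bot)+
qed

text \<open>The derivative is written in powers of \<open>sqrt s\<close> and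
  \<open>sqrt (t - s)\<close>, so that the later cancellation is rational algebra in these two
  roots.\<close>

lemma DERIV_sqrt_time_ratio:
  fixes s t :: real assumes s: "0 < s" "s < t"
  shows "((\<lambda>s. sqrt (s / (t - s))) has_real_derivative t / (2 * sqrt s * sqrt (t - s) ^ 3)) (at s)"
proof -
  have "((\<lambda>s. sqrt (s / (t - s))) has_real_derivative
      inverse (sqrt (s / (t - s))) / 2 * (t / (t - s)\<^sup>2)) (at s)"
    by (rule DERIV_chain2[OF DERIV_real_sqrt]) (use s in \<open>auto intro!: derivative_eq_intros simp: power2_eq_square\<close>)
  also have "(t - s)\<^sup>2 = sqrt (t - s) ^ 4"
    using s by (simp add: numeral_eq_Suc)
  also have "inverse (sqrt (s / (t - s))) / 2 * (t / sqrt (t - s) ^ 4) = t / (2 * sqrt s * sqrt (t - s) ^ 3)"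
    using s by (simp add: real_sqrt_divide inverse_eq_divide numeral_eq_Suc)
  finally show ?thesis .
qed

lemma DERIV_sqrt_time_ratio_inverse:
  fixes s t :: real assumes s: "0 < s" "s < t"
  shows "((\<lambda>s. sqrt ((t - s) / s)) has_real_derivative - t / (2 * sqrt s ^ 3 * sqrt (t - s))) (at s)"
proof -
  have "((\<lambda>s. sqrt ((t - s) / s)) has_real_derivative
      inverse (sqrt ((t - s) / s)) / 2 * (- t / s\<^sup>2)) (at s)"
    by (rule DERIV_chain2[OF DERIV_real_sqrt]) (use s in \<open>auto intro!: derivative_eq_intros simp: power2_eq_square\<close>)
  also have "s\<^sup>2 = sqrt s ^ 4"
    using s by (simp add: numeral_eq_Suc)
  also have "inverse (sqrt ((t - s) / s)) / 2 * (- t / sqrt s ^ 4) = - t / (2 * sqrt s ^ 3 * sqrt (t - s))"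
    using s by (simp add: real_sqrt_divide inverse_eq_divide numeral_eq_Suc)
  finally show ?thesis .
qed

text \<open>The factor \<open>b / s * heat s b\<close> is the first-passage density at level
  \<open>b\<close> of Brownian motion with variance \<open>2 * s\<close>. The identity is the strong
  Markov decomposition: a path from 0 to \<open>A + b\<close> first reaches \<open>b\<close> at some
  time \<open>s\<close> and covers the distance \<open>A\<close> in the remaining time. It is
  verified here by an explicit antiderivative in \<open>s\<close>.\<close>

lemma heat_hitting_integral:
  assumes t: "0 < t" and A: "0 < A" and b: "0 < b"
  shows "(\<integral>\<^sup>+s. ennreal (heat (t - s) A * (b / s * heat s b)) * indicator {0<..<t} s \<partial>lborel)
    = ennreal (heat t (A + b))"
proof -
  obtain E where E: "\<And>x. (E has_real_derivative heat t x) (at x)"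
    "(E \<longlongrightarrow> 1) at_top" "(E \<longlongrightarrow> 0) at_bot"
    using heat_primitive[OF t] by blast
  \<comment> \<open>The squares of \<open>p\<close> and \<open>q\<close> differ only in the sign of
    the cross term \<open>2 * A * b\<close>, which \<open>(A + b)^2\<close> and
    \<open>(A - b)^2\<close> respectively cancel. Hence \<open>heat t (p s) * c\<close> and
    \<open>heat t (q s) * d\<close> are the same function of \<open>s\<close>, and \<open>H\<close>
    combines the two primitives so that only the wanted term survives.\<close>
  define p where "p s = A * sqrt (s / (t - s)) - b * sqrt ((t - s) / s)" for s
  define q where "q s = A * sqrt (s / (t - s)) + b * sqrt ((t - s) / s)" for s
  define c where "c = heat t (A + b)"
  define d where "d = heat t (A - b)"
  define H where "H s = c * E (p s) - d * E (q s)" for s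
  let ?f = "\<lambda>s. heat (t - s) A * (b / s * heat s b)"
  have deriv: "(H has_real_derivative ?f s) (at s)" if s: "0 < s" "s < t" for s
  proof -
    define \<alpha> where "\<alpha> = sqrt s"
    define \<beta> where "\<beta> = sqrt (t - s)"
    have pos: "0 < \<alpha>" "0 < \<beta>" using s by (auto simp: \<alpha>_def \<beta>_def)
    have sq: "s = \<alpha>\<^sup>2" "t - s = \<beta>\<^sup>2" "t = \<alpha>\<^sup>2 + \<beta>\<^sup>2"
      using s by (auto simp: \<alpha>_def \<beta>_def)
    have ps: "p s = A * (\<alpha> / \<beta>) - b * (\<beta> / \<alpha>)" "q s = A * (\<alpha> / \<beta>) + b * (\<beta> / \<alpha>)"
      unfolding p_def q_def \<alpha>_def \<beta>_def by (simp_all add: real_sqrt_divide)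
    have e1: "(p s)\<^sup>2 + (A + b)\<^sup>2 = t * (A\<^sup>2 / (t - s) + b\<^sup>2 / s)"
    proof -
      have "(p s)\<^sup>2 + (A + b)\<^sup>2 = (\<alpha>\<^sup>2 + \<beta>\<^sup>2) * (A\<^sup>2 / \<beta>\<^sup>2 + b\<^sup>2 / \<alpha>\<^sup>2)"
        unfolding ps using pos
        by (simp add: power2_diff power2_sum power_mult_distrib power_divide distrib_left distrib_right
          add_divide_distrib mult_ac)
      then show ?thesis
        unfolding sq(1,2)[symmetric] by simp
    qed
    have e2: "(q s)\<^sup>2 + (A - b)\<^sup>2 = t * (A\<^sup>2 / (t - s) + b\<^sup>2 / s)"
    proof -
      have "(q s)\<^sup>2 + (A - b)\<^sup>2 = (\<alpha>\<^sup>2 + \<beta>\<^sup>2) * (A\<^sup>2 / \<beta>\<^sup>2 + b\<^sup>2 / \<alpha>\<^sup>2)"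
        unfolding ps using pos
        by (simp add: power2_diff power2_sum power_mult_distrib power_divide distrib_left distrib_right
          add_divide_distrib mult_ac)
      then show ?thesis
        unfolding sq(1,2)[symmetric] by simp
    qed
    have prod: "heat t x * heat t y = exp (- (A\<^sup>2 / (t - s) + b\<^sup>2 / s) / 4) / (4 * pi * t)"
      if "x\<^sup>2 + y\<^sup>2 = t * (A\<^sup>2 / (t - s) + b\<^sup>2 / s)" for x y
    proof -
      have scale: "- (t * X) / (4 * t) = - X / 4" for X
        using t by simp
      have "- x\<^sup>2 / (4 * t) + - y\<^sup>2 / (4 * t) = - (x\<^sup>2 + y\<^sup>2) / (4 * t)"
        by (simp add: add_divide_distrib diff_divide_distrib)
      also have "\<dots> = - (A\<^sup>2 / (t - s) + b\<^sup>2 / s) / 4"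
        unfolding that by (rule scale)
      finally show ?thesis
        using t by (simp add: heat_def flip: exp_add)
    qed
    have dp: "(p has_real_derivative A * (t / (2 * \<alpha> * \<beta> ^ 3)) - b * (- t / (2 * \<alpha> ^ 3 * \<beta>))) (at s)"
      unfolding p_def \<alpha>_def \<beta>_def by (intro DERIV_diff DERIV_cmult DERIV_sqrt_time_ratio DERIV_sqrt_time_ratio_inverse s)
    have dq: "(q has_real_derivative A * (t / (2 * \<alpha> * \<beta> ^ 3)) + b * (- t / (2 * \<alpha> ^ 3 * \<beta>))) (at s)"
      unfolding q_def \<alpha>_def \<beta>_def by (intro DERIV_add DERIV_cmult DERIV_sqrt_time_ratio DERIV_sqrt_time_ratio_inverse s)
    define e where "e = exp (- (A\<^sup>2 / (t - s) + b\<^sup>2 / s) / 4)"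
    have "(H has_real_derivative
        c * (heat t (p s) * (A * (t / (2 * \<alpha> * \<beta> ^ 3)) - b * (- t / (2 * \<alpha> ^ 3 * \<beta>))))
      - d * (heat t (q s) * (A * (t / (2 * \<alpha> * \<beta> ^ 3)) + b * (- t / (2 * \<alpha> ^ 3 * \<beta>))))) (at s)"
      unfolding H_def by (intro DERIV_diff DERIV_cmult DERIV_chain2[OF E(1)] dp dq)
    also have "c * (heat t (p s) * (A * (t / (2 * \<alpha> * \<beta> ^ 3)) - b * (- t / (2 * \<alpha> ^ 3 * \<beta>))))
      - d * (heat t (q s) * (A * (t / (2 * \<alpha> * \<beta> ^ 3)) + b * (- t / (2 * \<alpha> ^ 3 * \<beta>))))
      = (heat t (p s) * c) * (A * (t / (2 * \<alpha> * \<beta> ^ 3)) + b * (t / (2 * \<alpha> ^ 3 * \<beta>)))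
      - (heat t (q s) * d) * (A * (t / (2 * \<alpha> * \<beta> ^ 3)) - b * (t / (2 * \<alpha> ^ 3 * \<beta>)))"
      by (simp add: algebra_simps)
    also have "\<dots> = e / (4 * pi * t) * (A * (t / (2 * \<alpha> * \<beta> ^ 3)) + b * (t / (2 * \<alpha> ^ 3 * \<beta>)))
      - e / (4 * pi * t) * (A * (t / (2 * \<alpha> * \<beta> ^ 3)) - b * (t / (2 * \<alpha> ^ 3 * \<beta>)))"
      unfolding c_def d_def e_def prod[OF e1] prod[OF e2] ..
    \<comment> \<open>The terms with \<open>A\<close> cancel and those with \<open>b\<close>
      double.\<close>
    also have "\<dots> = e * b / (4 * pi * \<alpha> ^ 3 * \<beta>)"
      unfolding right_diff_distrib distrib_left using pos t by (simp add: mult_ac)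
    also have "\<dots> = ?f s"
    proof -
      have "e = exp (- A\<^sup>2 / (4 * (t - s))) * exp (- b\<^sup>2 / (4 * s))"
        unfolding e_def exp_add[symmetric]
        by (simp only: divide_divide_eq_left minus_divide_left add_divide_distrib minus_add_distrib)
           (simp only: mult.commute)
      moreover have "sqrt (4 * pi * (t - s)) * sqrt (4 * pi * s) = 4 * pi * (\<alpha> * \<beta>)"
        by (simp add: \<alpha>_def \<beta>_def real_sqrt_mult)
      moreover have "b / s = b / \<alpha>\<^sup>2"
        by (simp flip: sq(1))
      moreover have "?f s = (exp (- A\<^sup>2 / (4 * (t - s))) * exp (- b\<^sup>2 / (4 * s))) * (b / s)
          / (sqrt (4 * pi * (t - s)) * sqrt (4 * pi * s))"
        unfolding heat_def by (simp only: divide_divide_eq_left times_divide_eq_left times_divide_eq_right mult_ac)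
      ultimately have "?f s = e * (b / \<alpha>\<^sup>2) / (4 * pi * (\<alpha> * \<beta>))"
        by (simp only:)
      then show ?thesis
        by (simp add: power2_eq_square power3_eq_cube mult_ac)
    qed
    finally show ?thesis .
  qed
  \<comment> \<open>\<open>p\<close> runs from minus to plus infinity, whereas \<open>q\<close>
    tends to plus infinity at both ends. The contribution of \<open>q\<close> to the boundary values
    of \<open>H\<close> therefore drops out, and the total increment is \<open>c\<close>.\<close>
  have p0: "filterlim p at_bot (at_right 0)" and q0: "filterlim q at_top (at_right 0)"
    and pt: "filterlim p at_top (at_left t)" and qt: "filterlim q at_top (at_left t)"
    unfolding p_def q_def using t A b by real_asymp+
  have H0: "(H \<longlongrightarrow> c * 0 - d * 1) (at_right 0)"
    unfolding H_def
    by (intro tendsto_intros filterlim_compose[OF E(3) p0] filterlim_compose[OF E(2) q0])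
  have Ht: "(H \<longlongrightarrow> c * 1 - d * 1) (at_left t)"
    unfolding H_def
    by (intro tendsto_intros filterlim_compose[OF E(2) pt] filterlim_compose[OF E(2) qt])
  have cont: "isCont ?f s" if "0 < s" "s < t" for s
    unfolding heat_def using that by (auto intro!: continuous_intros)
  have nn: "0 \<le> ?f s" if "0 < s" "s < t" for s
    using that b by simp
  have H0': "((H \<circ> real_of_ereal) \<longlongrightarrow> c * 0 - d * 1) (at_right (ereal 0))"
    and Ht': "((H \<circ> real_of_ereal) \<longlongrightarrow> c * 1 - d * 1) (at_left (ereal t))"
    using H0 Ht by (simp_all only: ereal_tendsto_simps)
  have "set_integrable lborel (einterval (ereal 0) (ereal t)) ?f"
    "(LBINT s=ereal 0..ereal t. ?f s) = (c * 1 - d * 1) - (c * 0 - d * 1)"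
    by (rule interval_integral_FTC_nonneg[OF _ _ _ _ H0' Ht'];
        (rule AE_I2 impI)?; use t deriv cont nn in simp)+
  then have FTC: "set_integrable lborel {0<..<t} ?f" "(LBINT s=ereal 0..ereal t. ?f s) = c"
    by simp_all
  have "(\<integral>\<^sup>+s. ennreal (?f s) * indicator {0<..<t} s \<partial>lborel)
     = (\<integral>\<^sup>+s. ennreal (indicator {0<..<t} s * ?f s) \<partial>lborel)"
    by (intro nn_integral_cong) (auto simp: indicator_def)
  also have "\<dots> = ennreal (\<integral>s. indicator {0<..<t} s * ?f s \<partial>lborel)"
    using FTC(1) nn by (intro nn_integral_eq_integral)
      (auto simp: set_integrable_def indicator_def)
  also have "\<dots> = ennreal c"
    using FTC(2) t
    by (simp add: interval_lebesgue_integral_def set_lebesgue_integral_def)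
  finally show ?thesis unfolding c_def .
qed

text \<open>Since \<open>-2 * heat s b\<close> has derivative \<open>b / s * heat s b\<close> in
  \<open>b\<close>, a plain kernel is half an integral of passage densities. This brings a product
  of two kernels into the form of \<open>heat_hitting_integral\<close>.\<close>

lemma heat_as_hitting_integral:
  assumes s: "0 < s" and B: "0 < B"
  shows "ennreal (heat s B)
    = ennreal (1/2) * (\<integral>\<^sup>+b. ennreal (b / s * heat s b) * indicator {B..} b \<partial>lborel)"
proof -
  have "(\<integral>\<^sup>+b. ennreal (b / s * heat s b) * indicator {B..} b \<partial>lborel) = 0 - (- 2 * heat s B)"
  proof (rule nn_integral_FTC_atLeast)
    show "((\<lambda>b. - 2 * heat s b) has_real_derivative b / s * heat s b) (at b)" for b
      unfolding heat_def using s by (auto intro!: derivative_eq_intros simp: field_simps power2_eq_square)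
    show "((\<lambda>b. - 2 * heat s b) \<longlongrightarrow> 0) at_top"
      unfolding heat_def using s by real_asymp
  qed (use s B in auto)
  then show ?thesis
    using s by (simp only:) (subst ennreal_mult[symmetric], auto)
qed

text \<open>Replace the second kernel by its passage densities over levels \<open>b\<close> above
  \<open>B\<close>, exchange the integrals, evaluate the time integral for each \<open>b\<close>,
  and substitute \<open>c = A + b\<close>. Extended nonnegative integrals make the exchange free of
  integrability conditions.\<close>

lemma heat_bridge_integral:
  assumes t: "0 < t" and A: "0 < A" and B: "0 < B"
  shows "(\<integral>\<^sup>+s. ennreal (heat (t - s) A * heat s B) * indicator {0<..<t} s \<partial>lborel)
    = ennreal (1/2) * (\<integral>\<^sup>+c. ennreal (heat t c) * indicator {A + B<..} c \<partial>lborel)"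
proof -
  have "(\<integral>\<^sup>+s. ennreal (heat (t - s) A * heat s B) * indicator {0<..<t} s \<partial>lborel)
    = (\<integral>\<^sup>+s. (\<integral>\<^sup>+b. ennreal (1/2) * (ennreal (heat (t - s) A * (b / s * heat s b)) * indicator {B..} b
          * indicator {0<..<t} s) \<partial>lborel) \<partial>lborel)"
  proof (rule nn_integral_cong)
    fix s
    show "ennreal (heat (t - s) A * heat s B) * indicator {0<..<t} s
      = (\<integral>\<^sup>+b. ennreal (1/2) * (ennreal (heat (t - s) A * (b / s * heat s b)) * indicator {B..} b
          * indicator {0<..<t} s) \<partial>lborel)"
    proof (cases "0 < s \<and> s < t")
      case True
      have "(\<integral>\<^sup>+b. ennreal (1/2) * (ennreal (heat (t - s) A * (b / s * heat s b)) * indicator {B..} b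
          * indicator {0<..<t} s) \<partial>lborel)
        = (\<integral>\<^sup>+b. ennreal (heat (t - s) A) * (ennreal (1/2) * (ennreal (b / s * heat s b) * indicator {B..} b)) \<partial>lborel)"
        using True B by (intro nn_integral_cong) (auto simp: indicator_def ac_simps simp flip: ennreal_mult)
      also have "\<dots> = ennreal (heat (t - s) A) * ennreal (heat s B)"
        using True B by (simp add: nn_integral_cmult heat_as_hitting_integral[of s B])
      finally show ?thesis
        using True by (simp add: ennreal_mult)
    qed auto
  qed
  also have "\<dots> = (\<integral>\<^sup>+b. (\<integral>\<^sup>+s. ennreal (1/2) * (ennreal (heat (t - s) A * (b / s * heat s b)) * indicator {B..} b
          * indicator {0<..<t} s) \<partial>lborel) \<partial>lborel)"
    by (rule lborel_pair.Fubini') measurable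
  also have "\<dots> = (\<integral>\<^sup>+b. ennreal (1/2) * (ennreal (heat t (A + b)) * indicator {B..} b) \<partial>lborel)"
  proof (rule nn_integral_cong)
    fix b
    have "(\<integral>\<^sup>+s. ennreal (1/2) * (ennreal (heat (t - s) A * (b / s * heat s b)) * indicator {B..} b
          * indicator {0<..<t} s) \<partial>lborel)
      = (\<integral>\<^sup>+s. (ennreal (1/2) * indicator {B..} b) * (ennreal (heat (t - s) A * (b / s * heat s b))
          * indicator {0<..<t} s) \<partial>lborel)"
      by (simp add: ac_simps)
    also have "\<dots> = (ennreal (1/2) * indicator {B..} b) *
        (\<integral>\<^sup>+s. ennreal (heat (t - s) A * (b / s * heat s b)) * indicator {0<..<t} s \<partial>lborel)"
      by (rule nn_integral_cmult) measurable
    also have "\<dots> = ennreal (1/2) * (ennreal (heat t (A + b)) * indicator {B..} b)"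
      using heat_hitting_integral[OF t A, of b] B by (auto simp: indicator_def)
    finally show "(\<integral>\<^sup>+s. ennreal (1/2) * (ennreal (heat (t - s) A * (b / s * heat s b)) * indicator {B..} b
          * indicator {0<..<t} s) \<partial>lborel) = ennreal (1/2) * (ennreal (heat t (A + b)) * indicator {B..} b)" .
  qed
  also have "\<dots> = ennreal (1/2) * (\<integral>\<^sup>+b. ennreal (heat t (A + b)) * indicator {B..} b \<partial>lborel)"
    by (rule nn_integral_cmult) measurable
  also have "\<dots> = ennreal (1/2) * (\<integral>\<^sup>+b. ennreal (heat t (A + b)) * indicator {A + B<..} (A + b) \<partial>lborel)"
    by (intro arg_cong[where f = "(*) _"] nn_integral_cong_AE)
      (use AE_lborel_singleton[of B] in \<open>auto simp: indicator_def\<close>)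
  also have "\<dots> = ennreal (1/2) * (\<integral>\<^sup>+c. ennreal (heat t c) * indicator {A + B<..} c \<partial>lborel)"
    using nn_integral_real_affine[of "\<lambda>c. ennreal (heat t c) * indicator {A + B<..} c" 1 A] by simp
  finally show ?thesis .
qed

section \<open>Uniqueness for Gaussian transforms on the half-line\<close>

text \<open>Under \<open>x = exp (- u)\<close> the moments become integrals against all monomials in
  \<open>x\<close>, including the constant one. Weierstrass approximation on the unit interval then
  shows that \<open>h\<close> is orthogonal to itself.\<close>

lemma exp_moments_unique:
  fixes h :: "real \<Rightarrow> real"
  assumes cont: "continuous_on {0..} h"
    and lim: "(h \<longlongrightarrow> 0) at_top"
    and int: "set_integrable lborel {0..} h"
    and moments: "\<And>n::nat. (LBINT u:{0..}. exp (- real n * u) * h u) = 0"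
    and u: "0 \<le> u"
  shows "h u = 0"
proof -
  \<comment> \<open>The value 0 at \<open>x = 0\<close> corresponds to \<open>u\<close> at infinity;
    the limit of \<open>h\<close> there makes \<open>\<phi>\<close> continuous on the closed
    interval.\<close>
  define \<phi> where "\<phi> x = (if x \<le> 0 then 0 else h (- ln x))" for x :: real
  have \<phi>_exp: "\<phi> (exp (- u)) = h u" for u
    by (simp add: \<phi>_def)
  have "continuous_on {0..1} \<phi>"
    unfolding continuous_on_def
  proof
    fix x :: real assume x: "x \<in> {0..1}"
    show "(\<phi> \<longlongrightarrow> \<phi> x) (at x within {0..1})"
    proof (cases "x = 0")
      case True
      have "((\<lambda>x. h (- ln x)) \<longlongrightarrow> 0) (at_right 0)"
        by (rule filterlim_compose[OF lim]) real_asymp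
      then have "((\<lambda>x. h (- ln x)) \<longlongrightarrow> 0) (at 0 within {0..1})"
        by (simp add: at_within_Icc_at_right)
      then have "(\<phi> \<longlongrightarrow> 0) (at 0 within {0..1})"
        by (rule Lim_transform_eventually)
          (auto simp: eventually_at_filter \<phi>_def)
      then show ?thesis
        using True by (simp add: \<phi>_def)
    next
      case False
      with x have x: "0 < x" "x \<le> 1" by auto
      have "continuous_on {0<..1} (\<lambda>x. h (- ln x))"
        by (rule continuous_on_compose2[OF cont]) (auto intro!: continuous_intros)
      then have "((\<lambda>x. h (- ln x)) \<longlongrightarrow> h (- ln x)) (at x within {0<..1})"
        using x by (auto simp: continuous_on_def)
      then have "(\<phi> \<longlongrightarrow> h (- ln x)) (at x within {0<..1})"
        by (rule Lim_transform_eventually) (auto simp: eventually_at_filter \<phi>_def)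
      moreover have "at x within {0<..1} = at x within {0..1}"
        by (rule at_within_nhd[of x "{0<..}"]) (use x in auto)
      ultimately show ?thesis
        using x by (simp add: \<phi>_def)
    qed
  qed
  note \<phi>_cont = this
  have [measurable]: "(\<lambda>u. indicator {0..} u * h u) \<in> borel_measurable borel"
    using borel_measurable_continuous_on_indicator[OF _ cont] by simp
  define I where "I = (LBINT u:{0..}. \<bar>h u\<bar>)"
  obtain B where B: "\<forall>x\<in>{0..1}. \<bar>\<phi> x\<bar> \<le> B"
    using compact_imp_bounded[OF compact_continuous_image[OF \<phi>_cont compact_Icc]]
    unfolding bounded_iff by auto
  have hB: "\<bar>h u\<bar> \<le> B" if "0 \<le> u" for u
    using B[rule_format, of "exp (- u)"] that by (simp add: \<phi>_exp)
  have int_mult: "set_integrable lborel {0..} (\<lambda>u. g u * h u)"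
    if [measurable]: "g \<in> borel_measurable borel" and b: "\<And>u. 0 \<le> u \<Longrightarrow> \<bar>g u\<bar> \<le> C" for g C
  proof -
    have "integrable lborel (\<lambda>u. C * (indicator {0..} u * h u))"
      using int by (simp add: set_integrable_def)
    then have "integrable lborel (\<lambda>u. g u * (indicator {0..} u * h u))"
      by (rule Bochner_Integration.integrable_bound)
        (measurable, use b in \<open>auto simp: abs_mult indicator_def intro!: AE_I2 mult_right_mono intro: order.trans[OF _ abs_ge_self]\<close>)
    then show ?thesis
      by (simp add: set_integrable_def mult_ac)
  qed
  have sq_int: "set_integrable lborel {0..} (\<lambda>u. h u * h u)"
  proof -
    have "set_integrable lborel {0..} (\<lambda>u. (indicator {0..} u * h u) * h u)"
      by (rule int_mult[where C = B]) (use hB in \<open>auto simp: abs_mult\<close>)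
    then show ?thesis
      by (subst set_integrable_cong[OF refl refl]) auto
  qed
  \<comment> \<open>With a polynomial \<open>g\<close> within \<open>e\<close> of
    \<open>\<phi>\<close>, the vanishing moments allow \<open>g (exp (- u)) * h u\<close> to be
    subtracted from the square of \<open>h\<close> without changing its integral; what remains is at
    most \<open>e\<close> times the integral of the absolute value.\<close>
  have "(LBINT u:{0..}. h u * h u) \<le> e * I" if e: "0 < e" for e
  proof -
    obtain g where g: "real_polynomial_function g" "\<And>x. x \<in> {0..1} \<Longrightarrow> \<bar>\<phi> x - g x\<bar> < e"
      using Stone_Weierstrass_real_polynomial_function[OF compact_Icc \<phi>_cont e] by blast
    obtain a n where g_eq: "g = (\<lambda>x. \<Sum>i\<le>n. a i * x ^ i)"
      using g(1) real_polynomial_function_iff_sum by blast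
    have eq: "g (exp (- u)) * h u = (\<Sum>i\<le>n. a i * (exp (- real i * u) * h u))" for u
      unfolding g_eq sum_distrib_right by (simp add: mult_ac flip: exp_of_nat_mult)
    have int_i: "set_integrable lborel {0..} (\<lambda>u. exp (- real i * u) * h u)" for i
      by (rule int_mult[where C = 1]) auto
    have int_g: "set_integrable lborel {0..} (\<lambda>u. g (exp (- u)) * h u)"
      unfolding eq set_integrable_def scaleR_sum_right
      by (intro Bochner_Integration.integrable_sum set_integrable_mult_right[unfolded set_integrable_def]
        int_i[unfolded set_integrable_def])
    have "(LBINT u:{0..}. g (exp (- u)) * h u) = 0"
    proof -
      have "integrable lborel (\<lambda>u. indicator {0..} u *\<^sub>R (a i * (exp (- real i * u) * h u)))" for i
        using set_integrable_mult_right[OF int_i] by (simp add: set_integrable_def)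
      then have "(LBINT u:{0..}. g (exp (- u)) * h u)
          = (\<Sum>i\<le>n. LBINT u:{0..}. a i * (exp (- real i * u) * h u))"
        unfolding eq set_lebesgue_integral_def scaleR_sum_right
        by (rule Bochner_Integration.integral_sum)
      also have "\<dots> = 0"
        by (simp only: set_integral_mult_right moments mult_zero_right sum.neutral_const)
      finally show ?thesis .
    qed
    then have "(LBINT u:{0..}. h u * h u) = (LBINT u:{0..}. h u * h u - g (exp (- u)) * h u)"
      using set_integral_diff(2)[OF sq_int int_g] by simp
    also have "\<dots> \<le> (LBINT u:{0..}. e * \<bar>h u\<bar>)"
    proof (rule set_integral_mono)
      show "set_integrable lborel {0..} (\<lambda>u. h u * h u - g (exp (- u)) * h u)"
        by (rule set_integral_diff(1)[OF sq_int int_g])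
      show "set_integrable lborel {0..} (\<lambda>u. e * \<bar>h u\<bar>)"
        using set_integrable_abs[OF int] by (rule set_integrable_mult_right)
      fix u :: real assume "u \<in> {0..}"
      then have "\<bar>h u - g (exp (- u))\<bar> < e"
        using g(2)[of "exp (- u)"] by (simp add: \<phi>_exp)
      then have "\<bar>(h u - g (exp (- u))) * h u\<bar> \<le> e * \<bar>h u\<bar>"
        by (simp add: abs_mult mult_right_mono)
      then show "h u * h u - g (exp (- u)) * h u \<le> e * \<bar>h u\<bar>"
        by (simp add: left_diff_distrib)
    qed
    also have "\<dots> = e * I"
      by (simp add: I_def)
    finally show ?thesis .
  qed
  then have "eventually (\<lambda>e. (LBINT u:{0..}. h u * h u) \<le> e * I) (at_right 0)"
    by (auto simp: eventually_at_filter)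
  moreover have "((\<lambda>e. e * I) \<longlongrightarrow> 0 * I) (at_right 0)"
    by (intro tendsto_intros)
  ultimately have "(LBINT u:{0..}. h u * h u) \<le> 0"
    using tendsto_lowerbound[of "\<lambda>e. e * I" "0 * I" "at_right 0"] by simp
  moreover have "(LBINT u:{0..}. h u * h u) \<ge> 0"
    unfolding set_lebesgue_integral_def by (intro integral_nonneg_AE) auto
  ultimately have "(LBINT u:{0..}. h u * h u) = 0"
    by simp
  then have AE0: "AE u in lborel. indicator {0..} u * (h u * h u) = 0"
    using integral_nonneg_eq_0_iff_AE[of lborel "\<lambda>u. indicator {0..} u * (h u * h u)"] sq_int
    by (simp add: set_integrable_def set_lebesgue_integral_def)
  show "h u = 0"
  proof (rule ccontr)
    assume "h u \<noteq> 0"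
    \<comment> \<open>By continuity \<open>h\<close> would be nonzero on an interval to the right of
      \<open>u\<close>, which lies in the half-line even for \<open>u = 0\<close> and has positive
      measure.\<close>
    then have "eventually (\<lambda>x. h x \<noteq> 0) (at u within {0..})"
      using cont u by (intro tendsto_imp_eventually_ne[where c = "h u"]) (auto simp: continuous_on_def)
    then obtain d where d: "0 < d" "\<And>x. 0 \<le> x \<Longrightarrow> x \<noteq> u \<Longrightarrow> dist x u < d \<Longrightarrow> h x \<noteq> 0"
      by (auto simp: eventually_at)
    then have "AE x in lborel. x \<notin> {u<..<u+d}"
      using AE0 u by (auto simp: dist_real_def)
    then have "emeasure lborel {u<..<u+d} = 0"
      by (subst (asm) AE_iff_measurable[where N = "{u<..<u+d}"]) auto
    then show False
      using d(1) by simp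
  qed
qed

text \<open>Completing the square: \<open>t * (\<bar>k\<bar> + 1)^2\<close> is the maximum of
  \<open>- u^2 / (4 * t) + (\<bar>k\<bar> + 1) * \<bar>u\<bar>\<close>. The extra 1 in the rate pays
  for the decay \<open>exp (- \<bar>u\<bar>)\<close>.\<close>

lemma gaussian_times_exp_decay:
  fixes t :: real assumes t: "0 < t"
  obtains C where "0 < C" "\<And>u. exp (- u\<^sup>2 / (4 * t) + k * u) \<le> C * exp (- \<bar>u\<bar>)"
proof
  let ?C = "exp (t * (\<bar>k\<bar> + 1)\<^sup>2)"
  show "0 < ?C" by simp
  fix u :: real
  have "0 \<le> (\<bar>u\<bar> - 2 * t * (\<bar>k\<bar> + 1))\<^sup>2 / (4 * t)"
    using t by simp
  also have "\<dots> = u\<^sup>2 / (4 * t) - (\<bar>k\<bar> + 1) * \<bar>u\<bar> + t * (\<bar>k\<bar> + 1)\<^sup>2"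
    using t by (simp add: power2_diff diff_divide_distrib add_divide_distrib) (simp add: power2_eq_square field_simps)
  finally have "- u\<^sup>2 / (4 * t) + \<bar>k\<bar> * \<bar>u\<bar> \<le> t * (\<bar>k\<bar> + 1)\<^sup>2 - \<bar>u\<bar>"
    by (simp add: distrib_right)
  moreover have "k * u \<le> \<bar>k\<bar> * \<bar>u\<bar>"
    by (metis abs_ge_self abs_mult)
  ultimately show "exp (- u\<^sup>2 / (4 * t) + k * u) \<le> ?C * exp (- \<bar>u\<bar>)"
    by (simp flip: exp_add)
qed

lemma integrable_exp_neg_abs: "integrable lborel (\<lambda>x::real. exp (- \<bar>x\<bar>))"
proof -
  have *: "integrable lborel (\<lambda>x. indicator {0..} x * exp (- x::real))"
  proof (rule integrableI_nonneg)
    have "(\<integral>\<^sup>+x. ennreal (exp (- x)) * indicator {0..} x \<partial>lborel) = ennreal (0 - (- exp (- 0)))"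
    proof (rule nn_integral_FTC_atLeast)
      show "((\<lambda>x. - exp (- x)) \<longlongrightarrow> 0) (at_top :: real filter)"
        by real_asymp
    qed (auto intro!: derivative_eq_intros)
    moreover have "(\<integral>\<^sup>+x. ennreal (indicator {0..} x * exp (- x)) \<partial>lborel) =
      (\<integral>\<^sup>+x. ennreal (exp (- x)) * indicator {0..} x \<partial>lborel)"
      by (intro nn_integral_cong) (auto simp: indicator_def)
    ultimately show "(\<integral>\<^sup>+x. ennreal (indicator {0..} x * exp (- x)) \<partial>lborel) < \<infinity>"
      by simp
  qed auto
  have "integrable lborel (\<lambda>x. indicator {0..} (0 + (-1) * x) * exp (- (0 + (-1) * x::real)))"
    by (rule lborel_integrable_real_affine[OF *]) simp
  then have "integrable lborel (\<lambda>x. indicator {0..} x * exp (- x::real) + indicator {0..} (0 + (-1) * x) * exp (- (0 + (-1) * x)))"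
    using * by (intro Bochner_Integration.integrable_add)
  then show ?thesis
    by (rule Bochner_Integration.integrable_bound) (auto simp: indicator_def)
qed

text \<open>Moving \<open>y\<close> by \<open>2 * t * n\<close> multiplies the Gaussian by
  \<open>exp (- n * u)\<close>, up to a factor free of \<open>u\<close>. So one base point all of
  whose shifts are good yields every exponential moment of the Gaussian times \<open>m\<close>, and
  \<open>exp_moments_unique\<close> applies.\<close>

lemma gaussian_transform_unique:
  fixes m :: "real \<Rightarrow> real"
  assumes t: "0 < t" and cont: "continuous_on {0..} m"
    and bound: "\<And>u. 0 \<le> u \<Longrightarrow> \<bar>m u\<bar> \<le> C * exp (k * u)"
    and zero: "AE y in lborel. L < y \<longrightarrow> (LBINT u:{0..}. exp (- (u + y)\<^sup>2 / (4 * t)) * m u) = 0"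
    and u: "0 \<le> u"
  shows "m u = 0"
proof -
  define Z where "Z y \<longleftrightarrow> (LBINT u:{0..}. exp (- (u + y)\<^sup>2 / (4 * t)) * m u) = 0" for y
  \<comment> \<open>Translation invariance makes each shift good for almost every \<open>y\<close>;
    as there are countably many, almost every \<open>y\<close> is good for all of them at
    once.\<close>
  have "AE y in lborel. L < y + 2 * t * real n \<longrightarrow> Z (y + 2 * t * real n)" for n
  proof -
    have "AE y in lborel. L < y \<longrightarrow> Z y" using zero by (simp add: Z_def)
    then have "AE y in distr lborel borel ((+) (2 * t * real n)). L < y \<longrightarrow> Z y"
      by (subst lborel_distr_plus) simp
    then have "AE y in lborel. L < 2 * t * real n + y \<longrightarrow> Z (2 * t * real n + y)"
      by (rule AE_distrD[rotated]) simp
    then show ?thesis by (simp add: add.commute)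
  qed
  then have "AE y in lborel. \<forall>n. L < y + 2 * t * real n \<longrightarrow> Z (y + 2 * t * real n)"
    by (simp add: AE_all_countable)
  \<comment> \<open>The ray above \<open>L\<close> has positive measure, so it contains such a base
    point.\<close>
  moreover have "\<not> (AE y in lborel. \<not> L < y)"
  proof
    assume "AE y in lborel. \<not> L < y"
    then have "AE y in lborel. y \<notin> {L<..<L+1}" by auto
    then have "emeasure lborel {L<..<L+1} = 0"
      by (subst (asm) AE_iff_measurable[where N = "{L<..<L+1}"]) auto
    then show False by simp
  qed
  ultimately obtain y where y: "L < y" "\<And>n. L < y + 2 * t * real n \<Longrightarrow> Z (y + 2 * t * real n)"
    by (smt (verit, best) eventually_mono)
  have Z: "Z (y + 2 * t * real n)" for n
    by (rule y(2)) (use y(1) t in \<open>auto intro: less_le_trans\<close>)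
  define h where "h u = exp (- (u + y)\<^sup>2 / (4 * t)) * m u" for u
  obtain D where D: "0 < D" "\<And>u. exp (- u\<^sup>2 / (4 * t) + (k - y / (2 * t)) * u) \<le> D * exp (- \<bar>u\<bar>)"
    using gaussian_times_exp_decay[OF t] by blast
  define E where "E = exp (- y\<^sup>2 / (4 * t)) * \<bar>C\<bar> * D"
  have shift: "- (u + z)\<^sup>2 / (4 * t) = - z\<^sup>2 / (4 * t) - u\<^sup>2 / (4 * t) - z / (2 * t) * u" for u z
    using t by (simp add: power2_sum field_simps)
  have h_bound: "\<bar>h u\<bar> \<le> E * exp (- u)" if "0 \<le> u" for u
  proof -
    have "\<bar>h u\<bar> = exp (- (u + y)\<^sup>2 / (4 * t)) * \<bar>m u\<bar>"
      by (simp add: h_def abs_mult)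
    also have "\<dots> \<le> exp (- (u + y)\<^sup>2 / (4 * t)) * (\<bar>C\<bar> * exp (k * u))"
      using bound[OF that] by (intro mult_left_mono order.trans[OF bound[OF that]] mult_right_mono) auto
    also have "\<dots> = exp (- y\<^sup>2 / (4 * t)) * \<bar>C\<bar> * exp (- u\<^sup>2 / (4 * t) + (k - y / (2 * t)) * u)"
      unfolding shift by (simp add: algebra_simps flip: exp_add)
    also have "\<dots> \<le> exp (- y\<^sup>2 / (4 * t)) * \<bar>C\<bar> * (D * exp (- \<bar>u\<bar>))"
      by (intro mult_left_mono D) auto
    finally show ?thesis using that by (simp add: E_def mult_ac)
  qed
  have "h u = 0"
  proof (rule exp_moments_unique[OF _ _ _ _ u])
    show h_cont: "continuous_on {0..} h"
      unfolding h_def using cont t by (intro continuous_intros) auto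
    have "((\<lambda>u. E * exp (- u)) \<longlongrightarrow> 0) at_top"
      by real_asymp
    then show "(h \<longlongrightarrow> 0) at_top"
      by (rule Lim_null_comparison[rotated])
        (use h_bound in \<open>auto intro!: eventually_mono[OF eventually_ge_at_top[of 0]]\<close>)
    have [measurable]: "(\<lambda>u. indicator {0..} u * h u) \<in> borel_measurable borel"
      using borel_measurable_continuous_on_indicator[OF _ h_cont] by simp
    have "integrable lborel (\<lambda>u. indicator {0..} u * h u)"
      by (rule Bochner_Integration.integrable_bound[OF integrable_mult_right[OF integrable_exp_neg_abs, of E]])
        (measurable, use h_bound in \<open>auto simp: indicator_def intro!: AE_I2 intro: order.trans[OF _ abs_ge_self]\<close>)
    then show "set_integrable lborel {0..} h"
      by (simp add: set_integrable_def)
    fix n :: nat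
    define z where "z = y + 2 * t * real n"
    have "exp (- real n * u) * h u = exp (z\<^sup>2 / (4 * t) - y\<^sup>2 / (4 * t)) * (exp (- (u + z)\<^sup>2 / (4 * t)) * m u)" for u
    proof -
      have "z / (2 * t) = y / (2 * t) + real n"
        using t by (simp add: z_def field_simps)
      then have "- real n * u + - (u + y)\<^sup>2 / (4 * t) = z\<^sup>2 / (4 * t) - y\<^sup>2 / (4 * t) + - (u + z)\<^sup>2 / (4 * t)"
        unfolding shift by (simp add: distrib_right)
      then show ?thesis
        unfolding h_def mult.assoc[symmetric] exp_add[symmetric] by simp
    qed
    then show "(LBINT u:{0..}. exp (- real n * u) * h u) = 0"
      using Z[of n] by (simp add: Z_def flip: z_def)
  qed
  then show ?thesis by (simp add: h_def)
qed

section \<open>Reduction to a Gaussian average\<close>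

lemma integrable_pair_mult:
  fixes f :: "'a::euclidean_space \<Rightarrow> real" and g :: "'b::euclidean_space \<Rightarrow> real"
  assumes f: "integrable lborel f" and g: "integrable lborel g"
  shows "integrable (lborel \<Otimes>\<^sub>M lborel) (\<lambda>(x, y). f x * g y)"
proof -
  have [measurable]: "f \<in> borel_measurable borel" "g \<in> borel_measurable borel"
    using f g by auto
  show ?thesis
  proof (rule lborel_pair.Fubini_integrable)
    show "integrable lborel (\<lambda>x. \<integral>y. norm (case (x, y) of (x, y) \<Rightarrow> f x * g y) \<partial>lborel)"
      using f by (simp add: abs_mult)
  qed (use g in \<open>auto simp: split_beta'\<close>)
qed

text \<open>This is the integrand after the time integral has been traded for the variable
  \<open>c\<close> of \<open>heat_bridge_integral\<close>. The drift factors
  \<open>exp (a * (y - x))\<close> and \<open>exp (a * (x - z))\<close> have merged into one that is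
  free of \<open>x\<close>. Grouping \<open>(x, z)\<close> as a single point fits the exchanges of
  integrals below.\<close>

definition bridge_density :: "(real \<Rightarrow> real) \<Rightarrow> real \<Rightarrow> real \<Rightarrow> real \<Rightarrow> real \<times> real \<Rightarrow> real \<Rightarrow> real" where
  "bridge_density f a t y = (\<lambda>(x, z) c.
     if 0 \<le> z \<and> \<bar>y - x\<bar> + \<bar>x - z\<bar> < c then f x * exp (a * (y - z)) * heat t c else 0)"

lemma bridge_density_measurable [measurable]:
  assumes [measurable]: "f \<in> borel_measurable borel"
  shows "case_prod (bridge_density f a t y) \<in> borel_measurable (lborel \<Otimes>\<^sub>M lborel)"
  unfolding bridge_density_def split_beta' lborel_prod[symmetric] by measurable

text \<open>Where the density is nonzero, \<open>c\<close> exceeds both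
  \<open>\<bar>x - y\<bar>\<close> and \<open>\<bar>z - y\<bar>\<close>. Exponentials of these
  distances can thus be charged to the Gaussian in \<open>c\<close>, which leaves a product of
  integrable functions of \<open>x\<close>, \<open>z\<close> and \<open>c\<close> as a
  majorant.\<close>

lemma integrable_bridge_density:
  assumes t: "0 < t" and f [measurable]: "f \<in> borel_measurable borel"
    and f2: "integrable lborel (\<lambda>x. (f x)\<^sup>2)"
  shows "integrable (lborel \<Otimes>\<^sub>M lborel) (case_prod (bridge_density f a t y))"
proof -
  \<comment> \<open>One \<open>\<bar>a\<bar>\<close> absorbs the drift; the 2 buys the weights
    \<open>exp (- \<bar>x - y\<bar>)\<close> and \<open>exp (- \<bar>z - y\<bar>)\<close>.\<close>
  obtain D where D: "0 < D" "\<And>c. exp (- c\<^sup>2 / (4 * t) + (\<bar>a\<bar> + 2) * c) \<le> D * exp (- \<bar>c\<bar>)"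
    using gaussian_times_exp_decay[OF t] by blast
  have int_shift: "integrable lborel (\<lambda>z. exp (- \<bar>z - y\<bar>))"
    using lborel_integrable_real_affine[OF integrable_exp_neg_abs, of 1 "- y"] by simp
  \<comment> \<open>As \<open>f\<close> is only square integrable,
    \<open>\<bar>f x\<bar> \<le> 1 + (f x)^2\<close> is used under the weight.\<close>
  have int_f: "integrable lborel (\<lambda>x. exp (- \<bar>x - y\<bar>) * \<bar>f x\<bar>)"
  proof (rule Bochner_Integration.integrable_bound)
    show "integrable lborel (\<lambda>x. exp (- \<bar>x - y\<bar>) + (f x)\<^sup>2)"
      using int_shift f2 by (rule Bochner_Integration.integrable_add)
    show "AE x in lborel. norm (exp (- \<bar>x - y\<bar>) * \<bar>f x\<bar>) \<le> norm (exp (- \<bar>x - y\<bar>) + (f x)\<^sup>2)"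
    proof (rule AE_I2)
      fix x
      let ?e = "exp (- \<bar>x - y\<bar>)"
      have "?e * \<bar>f x\<bar> \<le> ?e * (1 + (f x)\<^sup>2)"
        using sum_squares_bound[of 1 "\<bar>f x\<bar>"] by (intro mult_left_mono) auto
      also have "\<dots> \<le> ?e + (f x)\<^sup>2"
        by (simp add: distrib_left mult_left_le_one_le)
      finally show "norm (?e * \<bar>f x\<bar>) \<le> norm (?e + (f x)\<^sup>2)"
        by simp
    qed
  qed measurable
  have "integrable (lborel \<Otimes>\<^sub>M lborel)
      (\<lambda>(p, c). (case p of (x, z) \<Rightarrow> (exp (- \<bar>x - y\<bar>) * \<bar>f x\<bar>) * exp (- \<bar>z - y\<bar>)) * (D / sqrt (4 * pi * t) * exp (- \<bar>c\<bar>)))"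
    using integrable_pair_mult[OF int_f int_shift]
    by (intro integrable_pair_mult integrable_mult_right integrable_exp_neg_abs) (simp add: lborel_prod)
  then show ?thesis
  proof (rule Bochner_Integration.integrable_bound)
    show "case_prod (bridge_density f a t y) \<in> borel_measurable (lborel \<Otimes>\<^sub>M lborel)"
      by measurable
    have "\<bar>bridge_density f a t y (x, z) c\<bar> \<le>
       ((exp (- \<bar>x - y\<bar>) * \<bar>f x\<bar>) * exp (- \<bar>z - y\<bar>)) * (D / sqrt (4 * pi * t) * exp (- \<bar>c\<bar>))" for x z c
    proof (cases "0 \<le> z \<and> \<bar>y - x\<bar> + \<bar>x - z\<bar> < c")
      case True
      then have c: "\<bar>x - y\<bar> \<le> c" "\<bar>z - y\<bar> \<le> c" by auto
      have "a * (y - z) \<le> \<bar>a\<bar> * \<bar>z - y\<bar>"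
        by (metis abs_ge_self abs_minus_commute abs_mult)
      also have "\<dots> \<le> \<bar>a\<bar> * c"
        using c by (intro mult_left_mono) auto
      finally have "a * (y - z) \<le> - \<bar>x - y\<bar> + - \<bar>z - y\<bar> + (\<bar>a\<bar> + 2) * c"
        using c by (simp add: distrib_right)
      then have "exp (a * (y - z)) \<le> exp (- \<bar>x - y\<bar> + - \<bar>z - y\<bar> + (\<bar>a\<bar> + 2) * c)"
        by simp
      then have "exp (a * (y - z)) * exp (- c\<^sup>2 / (4 * t))
          \<le> exp (- \<bar>x - y\<bar> + - \<bar>z - y\<bar> + (\<bar>a\<bar> + 2) * c) * exp (- c\<^sup>2 / (4 * t))"
        by (intro mult_right_mono) auto
      also have "\<dots> = exp (- \<bar>x - y\<bar>) * exp (- \<bar>z - y\<bar>) * exp (- c\<^sup>2 / (4 * t) + (\<bar>a\<bar> + 2) * c)"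
        unfolding exp_add by (simp only: mult_ac)
      also have "\<dots> \<le> exp (- \<bar>x - y\<bar>) * exp (- \<bar>z - y\<bar>) * (D * exp (- \<bar>c\<bar>))"
        by (intro mult_left_mono D) auto
      finally have "\<bar>f x\<bar> / sqrt (4 * pi * t) * (exp (a * (y - z)) * exp (- c\<^sup>2 / (4 * t)))
        \<le> \<bar>f x\<bar> / sqrt (4 * pi * t) * (exp (- \<bar>x - y\<bar>) * exp (- \<bar>z - y\<bar>) * (D * exp (- \<bar>c\<bar>)))"
        by (rule mult_left_mono) (use t in auto)
      then show ?thesis
        using True t by (simp add: bridge_density_def heat_def abs_mult mult_ac)
    next
      case False
      then show ?thesis using D t by (auto simp: bridge_density_def)
    qed
    then show "AE q in lborel \<Otimes>\<^sub>M lborel. norm (case_prod (bridge_density f a t y) q) \<le>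
      norm (case q of (p, c) \<Rightarrow> (case p of (x, z) \<Rightarrow> (exp (- \<bar>x - y\<bar>) * \<bar>f x\<bar>) * exp (- \<bar>z - y\<bar>)) * (D / sqrt (4 * pi * t) * exp (- \<bar>c\<bar>)))"
      by (intro AE_I2) (auto simp del: times_divide_eq_left times_divide_eq_right intro: order.trans[OF _ abs_ge_self])
  qed
qed

text \<open>The integrand of the hypothesis with \<open>w\<close> unfolded. The open condition on
  \<open>s\<close> keeps both kernel times positive.\<close>

definition duhamel_density :: "(real \<Rightarrow> real) \<Rightarrow> real \<Rightarrow> real \<Rightarrow> real \<Rightarrow> real \<times> real \<Rightarrow> real \<Rightarrow> real" where
  "duhamel_density f a t y = (\<lambda>(x, z) s.
     if 0 < s \<and> s < t \<and> 0 \<le> z then K a (t - s) (y - x) * (K a s (x - z) * f x) else 0)"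

lemma duhamel_density_eq:
  "duhamel_density f a t y (x, z) s = (if 0 \<le> z then f x * exp (a * (y - z)) else 0)
     * (heat (t - s) \<bar>y - x\<bar> * heat s \<bar>x - z\<bar> * indicator {0<..<t} s)"
proof -
  have "exp (a * (y - x)) * exp (a * (x - z)) = exp (a * (y - z))"
    by (simp add: algebra_simps flip: exp_add)
  then show ?thesis
    by (simp add: duhamel_density_def K_eq_heat indicator_def mult_ac)
qed

lemma duhamel_density_measurable [measurable]:
  assumes [measurable]: "f \<in> borel_measurable borel"
  shows "case_prod (duhamel_density f a t y) \<in> borel_measurable (lborel \<Otimes>\<^sub>M lborel)"
  unfolding duhamel_density_def K_eq_heat split_beta' lborel_prod[symmetric] by measurable

lemma bridge_density_eq:
  "bridge_density f a t y (x, z) c = (if 0 \<le> z then f x * exp (a * (y - z)) else 0)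
     * (heat t c * indicator {\<bar>y - x\<bar> + \<bar>x - z\<bar><..} c)"
  by (simp add: bridge_density_def indicator_def)

text \<open>The bridge integral requires both distances to be positive; this discards the null set
  where one of them vanishes.\<close>

lemma AE_distinct: "AE p in lborel. fst p \<noteq> (y::real) \<and> fst p \<noteq> (snd p :: real)"
proof -
  have "AE p in lborel \<Otimes>\<^sub>M lborel. fst p \<noteq> y \<and> fst p \<noteq> snd p"
  proof (rule lborel_pair.AE_pair_measure)
    show "AE x in lborel. AE z in lborel. fst (x, z) \<noteq> y \<and> fst (x, z) \<noteq> (snd (x, z) :: real)"
      using AE_lborel_singleton[of y]
    proof eventually_elim
      case (elim x)
      from AE_lborel_singleton[of x] show ?case by eventually_elim (use elim in auto)
    qed
  qed measurable
  then show ?thesis by (simp only: lborel_prod)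
qed

text \<open>Both densities are one factor \<open>q\<close>, free of \<open>s\<close> and
  \<open>c\<close>, times a nonnegative function, so the bridge integral gives both versions. The
  absolute version carries integrability over, the signed one the value.\<close>

lemma duhamel_bridge:
  assumes t: "0 < t" and "x \<noteq> y" "x \<noteq> z"
  shows "(\<integral>\<^sup>+s. ennreal \<bar>duhamel_density f a t y (x, z) s\<bar> \<partial>lborel)
      = ennreal (1/2) * (\<integral>\<^sup>+c. ennreal \<bar>bridge_density f a t y (x, z) c\<bar> \<partial>lborel)" (is ?abs)
    and "(\<integral>s. duhamel_density f a t y (x, z) s \<partial>lborel)
      = 1/2 * (\<integral>c. bridge_density f a t y (x, z) c \<partial>lborel)" (is ?int)
proof -
  define q where "q = (if 0 \<le> z then f x * exp (a * (y - z)) else 0)"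
  let ?h = "\<lambda>s. heat (t - s) \<bar>y - x\<bar> * heat s \<bar>x - z\<bar> * indicator {0<..<t} s"
  let ?g = "\<lambda>c. heat t c * indicator {\<bar>y - x\<bar> + \<bar>x - z\<bar><..} c"
  have h0: "0 \<le> ?h s" for s
    by (auto simp: indicator_def)
  have g0: "0 \<le> ?g c" for c
    using t by (auto simp: indicator_def)
  have *: "(\<integral>\<^sup>+s. ennreal (?h s) \<partial>lborel) = ennreal (1/2) * (\<integral>\<^sup>+c. ennreal (?g c) \<partial>lborel)"
    using heat_bridge_integral[OF t, of "\<bar>y - x\<bar>" "\<bar>x - z\<bar>"] assms
    by (simp add: ennreal_mult'' ennreal_indicator)
  show ?abs
  proof -
    have "(\<integral>\<^sup>+s. ennreal \<bar>duhamel_density f a t y (x, z) s\<bar> \<partial>lborel) = (\<integral>\<^sup>+s. ennreal \<bar>q\<bar> * ennreal (?h s) \<partial>lborel)"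
      unfolding duhamel_density_eq q_def[symmetric] abs_mult[of q] abs_of_nonneg[OF h0]
      by (simp only: ennreal_mult[OF abs_ge_zero h0])
    also have "\<dots> = ennreal \<bar>q\<bar> * (ennreal (1/2) * (\<integral>\<^sup>+c. ennreal (?g c) \<partial>lborel))"
      unfolding *[symmetric] by (rule nn_integral_cmult) measurable
    also have "\<dots> = ennreal (1/2) * (\<integral>\<^sup>+c. ennreal \<bar>q\<bar> * ennreal (?g c) \<partial>lborel)"
      by (subst nn_integral_cmult) (measurable, simp only: mult_ac)
    also have "\<dots> = ennreal (1/2) * (\<integral>\<^sup>+c. ennreal \<bar>bridge_density f a t y (x, z) c\<bar> \<partial>lborel)"
      unfolding bridge_density_eq q_def[symmetric] abs_mult[of q] abs_of_nonneg[OF g0]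
      by (simp only: ennreal_mult[OF abs_ge_zero g0])
    finally show ?thesis .
  qed
  have "(\<integral>s. ?h s \<partial>lborel) = enn2real (ennreal (1/2) * (\<integral>\<^sup>+c. ennreal (?g c) \<partial>lborel))"
    unfolding *[symmetric] by (rule integral_eq_nn_integral) (measurable, use h0 in auto)
  also have "\<dots> = 1/2 * enn2real (\<integral>\<^sup>+c. ennreal (?g c) \<partial>lborel)"
    by (simp only: enn2real_mult enn2real_ennreal)
  also have "\<dots> = 1/2 * (\<integral>c. ?g c \<partial>lborel)"
    by (subst integral_eq_nn_integral) (measurable, use g0 in auto)
  finally show ?int
    unfolding duhamel_density_eq bridge_density_eq q_def[symmetric] by simp
qed

text \<open>Tonelli reduces the claim to the bridge density, which avoids estimating the kernels
  near their singular times.\<close>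

lemma integrable_duhamel_density:
  assumes t: "0 < t" and f [measurable]: "f \<in> borel_measurable borel"
    and f2: "integrable lborel (\<lambda>x. (f x)\<^sup>2)"
  shows "integrable (lborel \<Otimes>\<^sub>M lborel) (case_prod (duhamel_density f a t y))"
proof (rule integrableI_bounded)
  have "(\<integral>\<^sup>+q. ennreal (norm (case_prod (duhamel_density f a t y) q)) \<partial>(lborel \<Otimes>\<^sub>M lborel))
      = (\<integral>\<^sup>+p. \<integral>\<^sup>+s. ennreal \<bar>duhamel_density f a t y p s\<bar> \<partial>lborel \<partial>lborel)"
    by (subst lborel.nn_integral_fst[symmetric]) auto
  also have "\<dots> = (\<integral>\<^sup>+p. ennreal (1/2) * \<integral>\<^sup>+c. ennreal \<bar>bridge_density f a t y p c\<bar> \<partial>lborel \<partial>lborel)"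
    by (rule nn_integral_cong_AE, use AE_distinct[of y] in eventually_elim) (metis duhamel_bridge(1)[OF t] prod.collapse)
  also have "\<dots> = ennreal (1/2) * (\<integral>\<^sup>+p. \<integral>\<^sup>+c. ennreal \<bar>bridge_density f a t y p c\<bar> \<partial>lborel \<partial>lborel)"
    by (rule nn_integral_cmult) measurable
  also have "\<dots> = ennreal (1/2) * (\<integral>\<^sup>+q. ennreal (norm (case_prod (bridge_density f a t y) q)) \<partial>(lborel \<Otimes>\<^sub>M lborel))"
    by (subst lborel.nn_integral_fst[symmetric]) auto
  also have "\<dots> < \<infinity>"
    using integrable_bridge_density[OF t f f2, of a y] ennreal_less_top[of "1/2"]
    unfolding integrable_iff_bounded infinity_ennreal_def ennreal_mult_less_top by blast
  finally show "(\<integral>\<^sup>+q. ennreal (norm (case_prod (duhamel_density f a t y) q)) \<partial>(lborel \<Otimes>\<^sub>M lborel)) < \<infinity>" .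
qed measurable

text \<open>Fubini moves the time integral innermost, where \<open>duhamel_bridge\<close> evaluates
  it; a second exchange moves \<open>c\<close> outermost. The \<open>x\<close> integral ends up
  innermost because it produces increments of the primitive of \<open>f\<close>.\<close>

lemma duhamel_eq_bridge:
  assumes t: "0 < t" and f [measurable]: "f \<in> borel_measurable borel"
    and f2: "integrable lborel (\<lambda>x. (f x)\<^sup>2)"
  shows "(LBINT s:{0..t}. U a (t - s) (\<lambda>x. w a s x * f x) y)
    = 1/2 * (\<integral>c. (\<integral>z. (\<integral>x. bridge_density f a t y (x, z) c \<partial>lborel) \<partial>lborel) \<partial>lborel)"
proof -
  let ?D = "duhamel_density f a t y" and ?B = "bridge_density f a t y"
  note D = integrable_duhamel_density[OF t f f2, of a y]
  note B = integrable_bridge_density[OF t f f2, of a y]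
  \<comment> \<open>At \<open>s = 0\<close> and \<open>s = t\<close> one kernel has time 0, where
    division by zero gives 0. The closed interval thus agrees with the open one of
    \<open>duhamel_density\<close> at every \<open>s\<close>.\<close>
  have K0: "K a 0 x = 0" for x by (simp add: K_def)
  have "(LBINT s:{0..t}. U a (t - s) (\<lambda>x. w a s x * f x) y)
      = (\<integral>s. (\<integral>x. (\<integral>z. ?D (x, z) s \<partial>lborel) \<partial>lborel) \<partial>lborel)"
    unfolding set_lebesgue_integral_def
  proof (rule Bochner_Integration.integral_cong[OF refl])
    fix s
    have "(\<integral>z. ?D (x, z) s \<partial>lborel) = indicator {0..t} s * (K a (t - s) (y - x) * (w a s x * f x))" for x
    proof -
      have "?D (x, z) s = indicator {0..t} s * (K a (t - s) (y - x) * ((indicator {0..} z *\<^sub>R K a s (x - z)) * f x))" for z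
        by (cases "s = 0 \<or> s = t") (auto simp: duhamel_density_def indicator_def K0)
      then show ?thesis
        by (simp add: w_def set_lebesgue_integral_def)
    qed
    then show "indicator {0..t} s *\<^sub>R U a (t - s) (\<lambda>x. w a s x * f x) y
        = (\<integral>x. (\<integral>z. ?D (x, z) s \<partial>lborel) \<partial>lborel)"
      by (simp add: U_def)
  qed
  also have "\<dots> = (\<integral>s. (\<integral>p. ?D p s \<partial>lborel) \<partial>lborel)"
  proof (rule integral_cong_AE)
    show "AE s in lborel. (\<integral>x. (\<integral>z. ?D (x, z) s \<partial>lborel) \<partial>lborel) = (\<integral>p. ?D p s \<partial>lborel)"
      using lborel_pair.AE_integrable_snd[OF D]
    proof eventually_elim
      case (elim s)
      then have "integrable (lborel \<Otimes>\<^sub>M lborel) (\<lambda>p. ?D p s)"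
        by (simp add: lborel_prod)
      from lborel_pair.integral_fst'[OF this] show ?case
        by (simp add: lborel_prod)
    qed
  qed measurable
  also have "\<dots> = (\<integral>p. (\<integral>s. ?D p s \<partial>lborel) \<partial>lborel)"
    by (rule lborel_pair.Fubini_integral[OF D])
  also have "\<dots> = (\<integral>p. 1/2 * (\<integral>c. ?B p c \<partial>lborel) \<partial>lborel)"
    by (rule integral_cong_AE, measurable, use AE_distinct[of y] in eventually_elim) (metis duhamel_bridge(2)[OF t] prod.collapse)
  also have "\<dots> = 1/2 * (\<integral>p. (\<integral>c. ?B p c \<partial>lborel) \<partial>lborel)"
    by simp
  also have "\<dots> = 1/2 * (\<integral>c. (\<integral>p. ?B p c \<partial>lborel) \<partial>lborel)"
    by (simp only: lborel_pair.Fubini_integral[OF B])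
  also have "\<dots> = 1/2 * (\<integral>c. (\<integral>z. (\<integral>x. ?B (x, z) c \<partial>lborel) \<partial>lborel) \<partial>lborel)"
  proof (intro arg_cong[where f = "(*) _"] integral_cong_AE)
    show "AE c in lborel. (\<integral>p. ?B p c \<partial>lborel) = (\<integral>z. (\<integral>x. ?B (x, z) c \<partial>lborel) \<partial>lborel)"
      using lborel_pair.AE_integrable_snd[OF B]
    proof eventually_elim
      case (elim c)
      then have "integrable (lborel \<Otimes>\<^sub>M lborel) (case_prod (\<lambda>x z. ?B (x, z) c))"
        by (simp add: lborel_prod split_beta')
      from lborel_pair.integral_snd[OF this] show ?case
        by (simp add: lborel_prod split_beta')
    qed
  qed measurable
  finally show ?thesis .
qed

section \<open>The antiderivative of the perturbation\<close>

definition lower_integral :: "(real \<Rightarrow> real) \<Rightarrow> real \<Rightarrow> real" where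
  "lower_integral f t = (LBINT x:{..t}. f x)"

text \<open>The positive and negative parts of \<open>g\<close> are densities of finite measures
  with equal distribution functions, hence of equal measures. So the two parts agree almost
  everywhere, and only zero has equal positive and negative parts.\<close>

lemma AE_eq_0_of_lower_integral:
  assumes g: "integrable lborel g" and zero: "\<And>t. lower_integral g t = 0"
  shows "AE x in lborel. g x = 0"
proof -
  have [measurable]: "g \<in> borel_measurable borel"
    using g by auto
  define M where "M h = density lborel (\<lambda>x. ennreal (max 0 (h x)))" for h :: "real \<Rightarrow> real"
  have int_max: "integrable lborel (\<lambda>x. max 0 (h x))" if "integrable lborel h" for h :: "real \<Rightarrow> real"
    using that by (intro integrable_max) auto
  have fin: "finite_borel_measure (M h)" if "integrable lborel h" for h
  proof (intro finite_borel_measure.intro finite_borel_measure_axioms.intro finite_measureI)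
    have [measurable]: "h \<in> borel_measurable borel" using that by auto
    have "emeasure (M h) (space (M h)) = (\<integral>\<^sup>+x. ennreal (norm (max 0 (h x))) \<partial>lborel)"
      by (simp add: M_def emeasure_density)
    also have "\<dots> < \<infinity>"
      using int_max[OF that] unfolding integrable_iff_bounded by blast
    finally show "emeasure (M h) (space (M h)) \<noteq> \<infinity>" by simp
  qed (simp add: M_def)
  have cdf_M: "cdf (M h) t = (\<integral>x. indicator {..t} x * max 0 (h x) \<partial>lborel)" if "integrable lborel h" for h t
  proof -
    have [measurable]: "h \<in> borel_measurable borel" using that by auto
    have "emeasure (M h) {..t} = (\<integral>\<^sup>+x. ennreal (indicator {..t} x * max 0 (h x)) \<partial>lborel)"
      by (auto simp: M_def emeasure_density indicator_def intro!: nn_integral_cong)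
    then show ?thesis
      by (subst integral_eq_nn_integral) (auto simp: cdf_def measure_def)
  qed
  have "cdf (M g) t = cdf (M (\<lambda>x. - g x)) t" for t
  proof -
    have "cdf (M g) t - cdf (M (\<lambda>x. - g x)) t
      = (\<integral>x. indicator {..t} x * max 0 (g x) - indicator {..t} x * max 0 (- g x) \<partial>lborel)"
      unfolding cdf_M[OF g] cdf_M[OF integrable_minus[OF g]]
      using integrable_mult_indicator[OF _ int_max[OF g], of "{..t}"]
        integrable_mult_indicator[OF _ int_max[OF integrable_minus[OF g]], of "{..t}"]
      by (intro Bochner_Integration.integral_diff[symmetric]) auto
    also have "\<dots> = lower_integral g t"
      unfolding lower_integral_def set_lebesgue_integral_def
      by (intro Bochner_Integration.integral_cong) (auto simp: indicator_def)
    finally show ?thesis by (simp add: zero)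
  qed
  then have "M g = M (\<lambda>x. - g x)"
    using cdf_unique'[OF fin[OF g] fin[OF integrable_minus[OF g]]] by auto
  then have "AE x in lborel. ennreal (max 0 (g x)) = ennreal (max 0 (- g x))"
    unfolding M_def by (subst (asm) finite_density_unique)
      (use int_max[OF g] in \<open>auto simp: integrable_iff_bounded\<close>)
  then show ?thesis
    by eventually_elim (auto simp: max_def split: if_splits)
qed

locale half_line_square_integrable =
  fixes f :: "real \<Rightarrow> real" and L :: real
  assumes L: "0 \<le> L"
    and f [measurable]: "f \<in> borel_measurable borel"
    and f2: "integrable lborel (\<lambda>x. (f x)\<^sup>2)"
    and supp: "AE x in lborel. x < - L \<longrightarrow> f x = 0"
begin

text \<open>The support condition cuts the ray down to \<open>{- L..t}\<close>, which has finite
  measure; there \<open>\<bar>f x\<bar> \<le> 1 + (f x)^2\<close> gives integrability and growth at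
  most linear in \<open>t\<close>.\<close>

lemma integrable_atMost: "integrable lborel (\<lambda>x. indicator {..t} x * f x)"
  and lower_integral_bound: "\<bar>lower_integral f t\<bar> \<le> (L + (\<integral>x. (f x)\<^sup>2 \<partial>lborel)) + \<bar>t\<bar>"
proof -
  have int_bound: "integrable lborel (\<lambda>x. indicator {- L..t} x + (f x)\<^sup>2)"
    using f2 by (intro Bochner_Integration.integrable_add integrable_real_indicator)
      (auto simp: emeasure_lborel_Icc_eq)
  have "\<bar>f x\<bar> \<le> 1 + (f x)\<^sup>2" for x
    using sum_squares_bound[of 1 "\<bar>f x\<bar>"] by auto
  note le = this
  from supp have bound: "AE x in lborel. norm (indicator {..t} x * f x) \<le> indicator {- L..t} x + (f x)\<^sup>2"
    by eventually_elim (use le in \<open>auto simp: indicator_def\<close>)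
  show int: "integrable lborel (\<lambda>x. indicator {..t} x * f x)"
    by (rule Bochner_Integration.integrable_bound[OF int_bound])
      (measurable, use bound in \<open>eventually_elim, simp add: indicator_def\<close>)
  have "\<bar>lower_integral f t\<bar> \<le> (\<integral>x. indicator {- L..t} x + (f x)\<^sup>2 \<partial>lborel)"
  proof -
    have "\<bar>lower_integral f t\<bar> \<le> (\<integral>x. norm (indicator {..t} x * f x) \<partial>lborel)"
      using integral_norm_bound[of lborel "\<lambda>x. indicator {..t} x * f x"]
      by (simp add: lower_integral_def set_lebesgue_integral_def)
    also have "\<dots> \<le> (\<integral>x. indicator {- L..t} x + (f x)\<^sup>2 \<partial>lborel)"
      by (rule integral_mono_AE[OF integrable_norm[OF int] int_bound bound])
    finally show ?thesis .
  qed
  also have "\<dots> = measure lborel {- L..t} + (\<integral>x. (f x)\<^sup>2 \<partial>lborel)"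
    using f2 by (subst Bochner_Integration.integral_add)
      (auto simp: emeasure_lborel_Icc_eq intro!: integrable_real_indicator)
  also have "measure lborel {- L..t} \<le> L + \<bar>t\<bar>"
    using L by (cases "- L \<le> t") auto
  finally show "\<bar>lower_integral f t\<bar> \<le> (L + (\<integral>x. (f x)\<^sup>2 \<partial>lborel)) + \<bar>t\<bar>" by simp
qed

lemma lower_integral_diff:
  assumes "l \<le> r"
  shows "(\<integral>x. indicator {l<..<r} x * f x \<partial>lborel) = lower_integral f r - lower_integral f l"
proof -
  have "(\<integral>x. indicator {l<..<r} x * f x \<partial>lborel)
      = (\<integral>x. indicator {..r} x * f x - indicator {..l} x * f x \<partial>lborel)"
    by (rule integral_cong_AE, measurable, use AE_lborel_singleton[of r] in eventually_elim)
      (use assms in \<open>auto simp: indicator_def\<close>)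
  also have "\<dots> = lower_integral f r - lower_integral f l"
    unfolding lower_integral_def set_lebesgue_integral_def
    using integrable_atMost by (subst Bochner_Integration.integral_diff) auto
  finally show ?thesis .
qed

lemma lower_integral_eq_0: "lower_integral f t = 0" if "t < - L"
proof -
  have "AE x in lborel. indicator {..t} x * f x = 0"
    using supp by eventually_elim (use that in \<open>auto simp: indicator_def\<close>)
  then show ?thesis
    unfolding lower_integral_def set_lebesgue_integral_def by (simp add: integral_eq_zero_AE)
qed

text \<open>Dominated convergence along a sequence: a bounded sequence stays below some
  \<open>T\<close>, and the indicators converge at every point except \<open>t\<close>. Continuity
  provides the primitive \<open>R\<close> used below.\<close>

lemma isCont_lower_integral: "isCont (lower_integral f) t"
  unfolding continuous_at_sequentially comp_def
proof (intro allI impI)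
  fix X assume X: "X \<longlonglongrightarrow> t"
  then have "Bseq X"
    using convergent_imp_Bseq convergentI by blast
  then obtain T where T: "\<And>n. \<bar>X n\<bar> \<le> T"
    by (auto simp: Bseq_def)
  have "(\<lambda>n. \<integral>x. indicator {..X n} x * f x \<partial>lborel) \<longlonglongrightarrow> (\<integral>x. indicator {..t} x * f x \<partial>lborel)"
  proof (rule integral_dominated_convergence)
    show "integrable lborel (\<lambda>x. \<bar>indicator {..T} x * f x\<bar>)"
      by (intro integrable_abs integrable_atMost)
    show "AE x in lborel. norm (indicator {..X n} x * f x) \<le> \<bar>indicator {..T} x * f x\<bar>" for n
      using T[of n] by (intro AE_I2) (auto simp: indicator_def)
    show "AE x in lborel. (\<lambda>n. indicator {..X n} x * f x) \<longlonglongrightarrow> indicator {..t} x * f x"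
      using AE_lborel_singleton[of t]
    proof eventually_elim
      case (elim x)
      have "eventually (\<lambda>n. indicator {..X n} x * f x = indicator {..t} x * f x) sequentially"
      proof (cases "x < t")
        case True
        from order_tendstoD(1)[OF X this] show ?thesis
          by eventually_elim (use True in \<open>auto simp: indicator_def\<close>)
      next
        case False
        with elim have "t < x" by auto
        from order_tendstoD(2)[OF X this] show ?thesis
          by eventually_elim (use \<open>t < x\<close> in \<open>auto simp: indicator_def\<close>)
      qed
      then show ?case by (rule tendsto_eventually)
    qed
  qed measurable
  then show "(\<lambda>n. lower_integral f (X n)) \<longlonglongrightarrow> lower_integral f t"
    by (simp add: lower_integral_def set_lebesgue_integral_def)
qed

text \<open>\<open>f\<close> is integrable on left rays but perhaps not on the whole line, so the
  previous criterion is applied to the truncations at every natural \<open>n\<close>.\<close>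

lemma AE_eq_0:
  assumes "\<And>t. lower_integral f t = 0"
  shows "AE x in lborel. f x = 0"
proof -
  have "AE x in lborel. indicator {..real n} x * f x = 0" for n
  proof (rule AE_eq_0_of_lower_integral[OF integrable_atMost])
    fix t
    have "lower_integral (\<lambda>x. indicator {..real n} x * f x) t = lower_integral f (min t n)"
      unfolding lower_integral_def set_lebesgue_integral_def
      by (intro Bochner_Integration.integral_cong) (auto simp: indicator_def)
    then show "lower_integral (\<lambda>x. indicator {..real n} x * f x) t = 0"
      using assms by simp
  qed
  then have "AE x in lborel. \<forall>n. indicator {..real n} x * f x = 0"
    unfolding AE_all_countable by blast
  then show ?thesis
  proof eventually_elim
    case (elim x)
    obtain n where "x \<le> real n" using real_arch_simple by blast
    with elim[rule_format, of n] show ?case by simp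
  qed
qed

text \<open>The points whose distances to \<open>y\<close> and \<open>z\<close> add up to less than
  \<open>c\<close> form a one-dimensional ellipse: the open interval with midpoint
  \<open>(y + z) / 2\<close> and length \<open>c\<close>, nonempty exactly when
  \<open>\<bar>z - y\<bar> < c\<close>.\<close>

lemma integral_bridge_density:
  "(\<integral>x. bridge_density f a t y (x, z) c \<partial>lborel)
    = exp (a * y) * heat t c * (if 0 \<le> z \<and> \<bar>z - y\<bar> < c
        then exp (- a * z) * (lower_integral f ((z + y + c) / 2) - lower_integral f ((z + y - c) / 2)) else 0)"
proof (cases "0 \<le> z \<and> \<bar>z - y\<bar> < c")
  case True
  have iff: "\<bar>y - x\<bar> + \<bar>x - z\<bar> < c \<longleftrightarrow> (z + y - c) / 2 < x \<and> x < (z + y + c) / 2" for x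
    using True by (auto simp: abs_if split: if_splits)
  have "exp (a * (y - z)) = exp (a * y) * exp (- a * z)"
    by (simp add: right_diff_distrib flip: exp_add)
  then have "bridge_density f a t y (x, z) c = (exp (a * y) * heat t c * exp (- a * z))
      * (indicator {(z + y - c) / 2<..<(z + y + c) / 2} x * f x)" for x
    using True unfolding bridge_density_def by (simp add: iff indicator_def)
  moreover have "0 \<le> c" using True by auto
  ultimately show ?thesis
    using True lower_integral_diff[of "(z + y - c) / 2" "(z + y + c) / 2"] by simp
next
  case False
  then have "bridge_density f a t y (x, z) c = 0" for x
    by (auto simp: bridge_density_def)
  with False show ?thesis by auto
qed

section \<open>Closed form of the inner integrals through a weighted primitive
  \<open>R\<close>\<close>

context
  fixes a :: real and R :: "real \<Rightarrow> real"
  assumes R: "\<And>s. (R has_real_derivative exp (- 2 * a * s) * lower_integral f s) (at s)"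
begin

text \<open>Substitute \<open>s = (z + v) / 2\<close>: then \<open>exp (- a * z)\<close> equals
  \<open>exp (a * v) * exp (- 2 * a * s)\<close>, which explains the weight in the derivative of
  \<open>R\<close>.\<close>

lemma window_integral:
  assumes "0 \<le> u"
  shows "(\<integral>z. (if 0 \<le> z \<and> z < u then exp (- a * z) * lower_integral f ((z + v) / 2) else 0) \<partial>lborel)
    = 2 * exp (a * v) * (R ((u + v) / 2) - R (v / 2))"
proof -
  let ?F = "\<lambda>z. 2 * exp (a * v) * R ((z + v) / 2)"
  let ?g = "\<lambda>z. exp (- a * z) * lower_integral f ((z + v) / 2)"
  have deriv: "(?F has_real_derivative ?g z) (at z)" for z
  proof -
    have "((\<lambda>z. R ((z + v) / 2)) has_real_derivative
        exp (- 2 * a * ((z + v) / 2)) * lower_integral f ((z + v) / 2) * (1 / 2)) (at z)"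
      by (rule DERIV_chain2[OF R]) (auto intro!: derivative_eq_intros)
    from DERIV_cmult[OF this, of "2 * exp (a * v)"]
    have "(?F has_real_derivative (exp (a * v) * exp (- 2 * a * ((z + v) / 2))) * lower_integral f ((z + v) / 2)) (at z)"
      by (simp add: mult_ac)
    also have "exp (a * v) * exp (- 2 * a * ((z + v) / 2)) = exp (- a * z)"
    proof -
      have "a * v + - 2 * a * ((z + v) / 2) = - a * z"
        by (simp add: field_simps)
      then show ?thesis by (simp only: exp_add[symmetric])
    qed
    finally show ?thesis .
  qed
  have cont: "isCont ?g z" for z
    by (intro continuous_intros isCont_o2[OF _ isCont_lower_integral]) auto
  have meas: "?g \<in> borel_measurable borel"
    using cont by (intro borel_measurable_continuous_onI continuous_at_imp_continuous_on) auto
  have "(\<integral>z. (if 0 \<le> z \<and> z < u then ?g z else 0) \<partial>lborel) = (\<integral>z. ?g z * indicator {0..u} z \<partial>lborel)"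
    by (rule integral_cong_AE, use meas in measurable, use AE_lborel_singleton[of u] in eventually_elim)
      (auto simp: indicator_def)
  also have "\<dots> = ?F u - ?F 0"
    using assms deriv cont by (intro integral_FTC_Icc_real) auto
  finally show ?thesis by (simp add: right_diff_distrib)
qed

text \<open>By the mean value inequality the increment is at most the derivative bound times
  \<open>\<bar>p - q\<bar>\<close>. The weight contributes the rate
  \<open>2 * \<bar>a\<bar>\<close>; the linear growth of the lower integral and the distance
  contribute 1 each.\<close>

lemma antiderivative_growth:
  obtains C where "\<And>u p q. \<bar>p\<bar> \<le> u \<Longrightarrow> \<bar>q\<bar> \<le> u \<Longrightarrow> \<bar>R p - R q\<bar> \<le> C * exp ((2 * \<bar>a\<bar> + 2) * u)"
proof
  define B where "B = L + (\<integral>x. (f x)\<^sup>2 \<partial>lborel) + 1"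
  have B: "1 \<le> B" using L by (simp add: B_def)
  fix u p q :: real assume pq: "\<bar>p\<bar> \<le> u" "\<bar>q\<bar> \<le> u"
  have R': "norm (exp (- 2 * a * s) * lower_integral f s) \<le> B * exp ((2 * \<bar>a\<bar> + 1) * u)" if s: "s \<in> {- u..u}" for s
  proof -
    have su: "\<bar>s\<bar> \<le> u" using s by auto
    have "\<bar>lower_integral f s\<bar> \<le> B - 1 + \<bar>s\<bar>"
      using lower_integral_bound[of s] by (simp add: B_def)
    also have "\<dots> \<le> B * (1 + u)"
      using B su by (simp add: distrib_left) (smt (verit) mult_le_cancel_right1)
    also have "\<dots> \<le> B * exp u"
      using B by (intro mult_left_mono) auto
    finally have 1: "\<bar>lower_integral f s\<bar> \<le> B * exp u" .
    have "- 2 * a * s \<le> 2 * \<bar>a\<bar> * \<bar>s\<bar>"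
      using abs_ge_self[of "- 2 * a * s"] by (simp add: abs_mult)
    also have "\<dots> \<le> 2 * \<bar>a\<bar> * u"
      using su by (intro mult_left_mono) auto
    finally have "exp (- 2 * a * s) \<le> exp (2 * \<bar>a\<bar> * u)" by simp
    from mult_mono[OF this 1] have "exp (- 2 * a * s) * \<bar>lower_integral f s\<bar> \<le> exp (2 * \<bar>a\<bar> * u) * (B * exp u)"
      by simp
    moreover have "exp ((2 * \<bar>a\<bar> + 1) * u) = exp (2 * \<bar>a\<bar> * u) * exp u"
      by (simp add: distrib_right exp_add)
    ultimately show ?thesis
      by (simp add: abs_mult mult_ac)
  qed
  have "norm (R p - R q) \<le> B * exp ((2 * \<bar>a\<bar> + 1) * u) * norm (p - q)"
    by (rule field_differentiable_bound[where S = "{- u..u}"])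
      (use R' pq in \<open>auto intro: has_field_derivative_at_within R simp del: norm_mult\<close>)
  also have "\<dots> \<le> B * exp ((2 * \<bar>a\<bar> + 1) * u) * (2 * exp u)"
  proof (rule mult_left_mono)
    have "norm (p - q) \<le> 2 * u" using pq by auto
    also have "\<dots> \<le> 2 * exp u" using exp_ge_add_one_self[of u] by linarith
    finally show "norm (p - q) \<le> 2 * exp u" .
  qed (use B in auto)
  also have "\<dots> = 2 * B * exp ((2 * \<bar>a\<bar> + 2) * u)"
  proof -
    have "exp ((2 * \<bar>a\<bar> + 1) * u) * exp u = exp ((2 * \<bar>a\<bar> + 2) * u)"
      by (simp add: algebra_simps flip: exp_add)
    then show ?thesis by (simp add: mult_ac)
  qed
  finally show "\<bar>R p - R q\<bar> \<le> 2 * B * exp ((2 * \<bar>a\<bar> + 2) * u)" by simp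
qed

text \<open>Supplies the growth hypothesis of \<open>gaussian_transform_unique\<close> for both
  functions that occur below, with \<open>d = a\<close> for negative \<open>y\<close> and
  \<open>d = - a\<close> for positive \<open>y\<close>.\<close>

lemma window_growth:
  assumes "\<bar>d\<bar> \<le> \<bar>a\<bar>" "\<And>u. 0 \<le> u \<Longrightarrow> \<bar>p u\<bar> \<le> u" "\<And>u. 0 \<le> u \<Longrightarrow> \<bar>q u\<bar> \<le> u"
  obtains C where "\<And>u. 0 \<le> u \<Longrightarrow> \<bar>2 * exp (d * u) * (R (p u) - R (q u))\<bar> \<le> C * exp ((3 * \<bar>a\<bar> + 2) * u)"
proof -
  obtain C where C: "\<And>u p q. \<bar>p\<bar> \<le> u \<Longrightarrow> \<bar>q\<bar> \<le> u \<Longrightarrow> \<bar>R p - R q\<bar> \<le> C * exp ((2 * \<bar>a\<bar> + 2) * u)"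
    using antiderivative_growth by blast
  show ?thesis
  proof
    fix u :: real assume u: "0 \<le> u"
    have "d * u \<le> \<bar>a\<bar> * u"
      using assms(1) u by (intro mult_right_mono) auto
    then have "exp (d * u) * \<bar>R (p u) - R (q u)\<bar> \<le> exp (\<bar>a\<bar> * u) * (C * exp ((2 * \<bar>a\<bar> + 2) * u))"
      using assms(2,3)[OF u] by (intro mult_mono C) auto
    also have "\<dots> = C * exp ((3 * \<bar>a\<bar> + 2) * u)"
    proof -
      have "\<bar>a\<bar> * u + (2 * \<bar>a\<bar> + 2) * u = (3 * \<bar>a\<bar> + 2) * u" by (simp add: algebra_simps)
      then show ?thesis by (simp add: mult.left_commute flip: exp_add)
    qed
    finally show "\<bar>2 * exp (d * u) * (R (p u) - R (q u))\<bar> \<le> (2 * C) * exp ((3 * \<bar>a\<bar> + 2) * u)"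
      by (simp add: abs_mult)
  qed
qed

lemma isCont_R: "isCont R s"
  by (rule DERIV_isCont[OF R])

lemma gaussian_shift:
  fixes M :: "real \<Rightarrow> real"
  assumes t: "0 < t"
    and zero: "(\<integral>c. exp (a * y) * heat t c * (if 0 \<le> c + v then M (c + v) else 0) \<partial>lborel) = 0"
  shows "(LBINT u:{0..}. exp (- (u - v)\<^sup>2 / (4 * t)) * M u) = 0"
proof -
  have "(\<integral>c. exp (a * y) * heat t c * (if 0 \<le> c + v then M (c + v) else 0) \<partial>lborel)
      = (\<integral>u. exp (a * y) * heat t (u - v) * (if 0 \<le> u then M u else 0) \<partial>lborel)"
    using lborel_integral_real_affine[of 1
        "\<lambda>c. exp (a * y) * heat t c * (if 0 \<le> c + v then M (c + v) else 0)" "- v"]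
    by (simp cong: if_cong)
  also have "\<dots> = exp (a * y) / sqrt (4 * pi * t) * (LBINT u:{0..}. exp (- (u - v)\<^sup>2 / (4 * t)) * M u)"
  proof -
    have "exp (a * y) * heat t (u - v) * (if 0 \<le> u then M u else 0)
        = exp (a * y) / sqrt (4 * pi * t) * (indicator {0..} u *\<^sub>R (exp (- (u - v)\<^sup>2 / (4 * t)) * M u))" for u
      by (simp add: heat_def)
    then show ?thesis
      by (simp only: set_lebesgue_integral_def integral_mult_right_zero)
  qed
  finally show ?thesis
    using t zero by simp
qed

text \<open>For \<open>z \<ge> 0\<close> the modulus opens as \<open>z - y\<close>, so the window is
  \<open>z < c + y\<close>. In it the lower endpoint \<open>(z + y - c) / 2\<close> lies below
  \<open>y\<close>, hence left of the support, and only the upper endpoint contributes.\<close>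

lemma bridge_left:
  assumes "y < - L"
  shows "(\<integral>z. (\<integral>x. bridge_density f a t y (x, z) c \<partial>lborel) \<partial>lborel)
    = exp (a * y) * heat t c * (if 0 \<le> c + y then 2 * exp (a * (c + y)) * (R (c + y) - R ((c + y) / 2)) else 0)"
proof -
  have y: "y < 0" using assms L by simp
  have eq: "(if 0 \<le> z \<and> \<bar>z - y\<bar> < c
        then exp (- a * z) * (lower_integral f ((z + y + c) / 2) - lower_integral f ((z + y - c) / 2)) else 0)
      = (if 0 \<le> z \<and> z < c + y then exp (- a * z) * lower_integral f ((z + (c + y)) / 2) else 0)" for z
    using y assms lower_integral_eq_0[of "(z + y - c) / 2"] by (auto simp: abs_if ac_simps)
  show ?thesis
  proof (cases "0 \<le> c + y")
    case True
    have "(c + y + (c + y)) / 2 = c + y" by simp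
    with True show ?thesis
      unfolding integral_bridge_density eq using window_integral[OF True, of "c + y"] by (simp only:) simp
  next
    case False
    then have "(if 0 \<le> z \<and> z < c + y then g else 0) = 0" for z g :: real by auto
    with False show ?thesis
      unfolding integral_bridge_density eq by simp
  qed
qed

text \<open>Here the upper endpoint is nonnegative, where the lower integral is already known to
  vanish. The lower endpoint is negative only for \<open>z < c - y\<close>, which gives the window,
  and it enters with a minus sign.\<close>

lemma bridge_right:
  assumes y: "0 < y" and zero: "\<forall>s\<ge>0. lower_integral f s = 0"
  shows "(\<integral>z. (\<integral>x. bridge_density f a t y (x, z) c \<partial>lborel) \<partial>lborel)
    = exp (a * y) * heat t c * (if 0 \<le> c - y then 2 * exp (- a * (c - y)) * (R (- (c - y) / 2) - R 0) else 0)"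
proof -
  have eq: "(if 0 \<le> z \<and> \<bar>z - y\<bar> < c
        then exp (- a * z) * (lower_integral f ((z + y + c) / 2) - lower_integral f ((z + y - c) / 2)) else 0)
      = - (if 0 \<le> z \<and> z < c - y then exp (- a * z) * lower_integral f ((z + - (c - y)) / 2) else 0)" for z
    using y zero[rule_format, of "(z + y + c) / 2"]
      zero[rule_format, of "(z + y - c) / 2"] by (auto simp: abs_if algebra_simps)
  show ?thesis
  proof (cases "0 \<le> c - y")
    case True
    have 0: "(c - y + - (c - y)) / 2 = 0" by simp
    show ?thesis
      unfolding integral_bridge_density eq integral_mult_right_zero Bochner_Integration.integral_minus
        window_integral[OF True] 0
      using True by (simp add: right_diff_distrib)
  next
    case False
    then have "(if 0 \<le> z \<and> z < c - y then g else 0) = 0" for z g :: real by auto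
    with False show ?thesis
      unfolding integral_bridge_density eq by simp
  qed
qed

end

section \<open>Vanishing of the primitive on both half-lines\<close>

lemma lower_integral_eq_0_of_bridge:
  assumes t: "0 < t"
    and zero: "AE y in lborel.
      (\<integral>c. (\<integral>z. (\<integral>x. bridge_density f a t y (x, z) c \<partial>lborel) \<partial>lborel) \<partial>lborel) = 0"
  shows "lower_integral f s = 0"
proof -
  obtain R where R: "\<And>s. (R has_real_derivative exp (- 2 * a * s) * lower_integral f s) (at s)"
  proof -
    have "isCont (\<lambda>s. exp (- 2 * a * s) * lower_integral f s) s" for s
      by (intro continuous_intros isCont_lower_integral)
    then show ?thesis
      using einterval_antiderivative[of "-\<infinity>" \<infinity> "\<lambda>s. exp (- 2 * a * s) * lower_integral f s"] that
      by (auto simp: has_real_derivative_iff_has_vector_derivative)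
  qed
  have contR: "continuous_on S (\<lambda>u. R (g u))" if "continuous_on S g" for S and g :: "real \<Rightarrow> real"
    by (rule continuous_on_compose2[OF _ that, of UNIV])
      (auto intro!: continuous_at_imp_continuous_on isCont_R[OF R])
  have half: "R u = R (u / 2)" if u: "0 \<le> u" for u
  proof -
    let ?M = "\<lambda>u. 2 * exp (a * u) * (R u - R (u / 2))"
    obtain C where C: "\<And>u. 0 \<le> u \<Longrightarrow> \<bar>?M u\<bar> \<le> C * exp ((3 * \<bar>a\<bar> + 2) * u)"
      using window_growth[OF R, of a "\<lambda>u. u" "\<lambda>u. u / 2"] by auto
    have "AE y in lborel. y < - L \<longrightarrow> (LBINT u:{0..}. exp (- (u - y)\<^sup>2 / (4 * t)) * ?M u) = 0"
      using zero
    proof eventually_elim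
      case (elim y)
      show ?case
      proof
        assume "y < - L"
        from elim[unfolded bridge_left[OF R this]]
        show "(LBINT u:{0..}. exp (- (u - y)\<^sup>2 / (4 * t)) * ?M u) = 0"
          by (rule gaussian_shift[OF R t])
      qed
    qed
    \<comment> \<open>Reflecting \<open>y\<close> turns the ray below \<open>- L\<close> into the
      ray above \<open>L\<close>, as \<open>gaussian_transform_unique\<close> expects.\<close>
    then have "AE y in distr lborel borel uminus. y < - L \<longrightarrow> (LBINT u:{0..}. exp (- (u - y)\<^sup>2 / (4 * t)) * ?M u) = 0"
      by (subst lborel_distr_uminus)
    then have "AE y in lborel. - y < - L \<longrightarrow> (LBINT u:{0..}. exp (- (u - - y)\<^sup>2 / (4 * t)) * ?M u) = 0"
      by (rule AE_distrD[rotated]) simp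
    then have "AE y in lborel. L < y \<longrightarrow> (LBINT u:{0..}. exp (- (u + y)\<^sup>2 / (4 * t)) * ?M u) = 0"
      by simp
    note AE = this
    have "?M u = 0"
    proof (rule gaussian_transform_unique[where m = ?M and u = u, OF t])
      show "continuous_on {0..} ?M"
        by (auto intro!: continuous_intros contR)
      show "AE y in lborel. L < y \<longrightarrow> (LBINT u:{0..}. exp (- (u + y)\<^sup>2 / (4 * t)) * ?M u) = 0"
        by (rule AE)
    qed (fact C u)+
    then show ?thesis by simp
  qed
  have R_pos: "R u = R 0" if u: "0 \<le> u" for u
  proof -
    \<comment> \<open>Iterated halving drives the argument to 0, where \<open>R\<close> is
      continuous.\<close>
    have pow: "R (u / 2 ^ n) = R u" for n
    proof (induction n)
      case (Suc n)
      then show ?case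
        using half[of "u / 2 ^ n"] u by (simp add: mult.commute)
    qed simp
    have "(\<lambda>n. R (u / 2 ^ n)) \<longlonglongrightarrow> R 0"
      by (rule isCont_tendsto_compose[OF isCont_R[OF R]]) real_asymp
    then show ?thesis
      by (simp add: LIMSEQ_const_iff pow)
  qed
  \<comment> \<open>Where \<open>R\<close> is locally constant its derivative vanishes, and the
    exponential weight in that derivative is never zero.\<close>
  have zero_of_const: "lower_integral f s = 0" if "open S" "s \<in> S" "\<And>v. v \<in> S \<Longrightarrow> R v = R 0" for S s
  proof -
    have "(R has_real_derivative 0) (at s)"
      by (rule has_field_derivative_transform_within_open[OF DERIV_const that(1,2)])
        (rule that(3)[symmetric])
    from DERIV_unique[OF this R] show ?thesis by simp
  qed
  have pos: "lower_integral f s = 0" if "0 \<le> s" for s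
  proof (cases "s = 0")
    case True
    \<comment> \<open>At \<open>s = 0\<close> constancy of \<open>R\<close> is known only on the
      right, so the value is obtained as a right limit.\<close>
    have "(lower_integral f \<longlongrightarrow> lower_integral f 0) (at_right 0)"
      using isCont_lower_integral[of 0] by (simp add: isCont_def filterlim_at_split)
    moreover have "eventually (\<lambda>s. lower_integral f s = 0) (at_right 0)"
      using eventually_at_right_less[of 0]
      by eventually_elim (rule zero_of_const[of "{0<..}"], auto intro: R_pos)
    then have "(lower_integral f \<longlongrightarrow> 0) (at_right 0)"
      by (rule tendsto_eventually)
    ultimately show ?thesis
      using True tendsto_unique trivial_limit_at_right_real by blast
  next
    case False
    with that show ?thesis
      by (intro zero_of_const[of "{0<..}"]) (auto intro: R_pos)
  qed
  then have pos': "\<forall>s\<ge>0. lower_integral f s = 0" by blast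
  have R_neg: "R (- u / 2) = R 0" if u: "0 \<le> u" for u
  proof -
    let ?M = "\<lambda>u. 2 * exp (- a * u) * (R (- u / 2) - R 0)"
    obtain C where C: "\<And>u. 0 \<le> u \<Longrightarrow> \<bar>?M u\<bar> \<le> C * exp ((3 * \<bar>a\<bar> + 2) * u)"
      using window_growth[OF R, of "- a" "\<lambda>u. - u / 2" "\<lambda>u. 0"] by auto
    have "AE y in lborel. 0 < y \<longrightarrow> (LBINT u:{0..}. exp (- (u + y)\<^sup>2 / (4 * t)) * ?M u) = 0"
      using zero
    proof eventually_elim
      case (elim y)
      show ?case
      proof
        assume "0 < y"
        from elim[unfolded bridge_right[OF R this pos']]
        show "(LBINT u:{0..}. exp (- (u + y)\<^sup>2 / (4 * t)) * ?M u) = 0"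
          by (rule gaussian_shift[OF R t, of y "- y" ?M, unfolded add_uminus_conv_diff diff_minus_eq_add])
      qed
    qed
    note AE = this
    have "?M u = 0"
    proof (rule gaussian_transform_unique[where m = ?M and u = u, OF t])
      show "continuous_on {0..} ?M"
        by (auto intro!: continuous_intros contR)
      show "AE y in lborel. 0 < y \<longrightarrow> (LBINT u:{0..}. exp (- (u + y)\<^sup>2 / (4 * t)) * ?M u) = 0"
        by (rule AE)
    qed (fact C u)+
    then show ?thesis by simp
  qed
  \<comment> \<open>A negative \<open>v\<close> is reached as \<open>- u / 2\<close> with
    \<open>u = - 2 * v\<close>.\<close>
  have "R v = R 0" for v
    using R_pos[of v] R_neg[of "- 2 * v"] by (cases "0 \<le> v") auto
  then show ?thesis
    by (intro zero_of_const[OF open_UNIV UNIV_I])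
qed

end

theorem theorem1:
  fixes a \<tau>s L :: real and f :: "real \<Rightarrow> real"
  assumes "\<tau>s > 0" and "L \<ge> 0"
    and "f \<in> borel_measurable lborel"
    and "integrable lborel (\<lambda>x. (f x)\<^sup>2)"
    and "AE x in lborel. x < - L \<longrightarrow> f x = 0"
    and "AE y in lborel.
           (\<integral>s\<in>{0..\<tau>s}. U a (\<tau>s - s) (\<lambda>x. w a s x * f x) y \<partial>lborel) = 0"
  shows "AE x in lborel. f x = 0"
proof -
  have f: "f \<in> borel_measurable borel" using assms(3) by simp
  interpret half_line_square_integrable f L
    by standard (use assms f in auto)
  have "AE y in lborel.
      (\<integral>c. (\<integral>z. (\<integral>x. bridge_density f a \<tau>s y (x, z) c \<partial>lborel) \<partial>lborel) \<partial>lborel) = 0"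
    using assms(6) by (simp add: duhamel_eq_bridge[OF assms(1) f assms(4)])
  then show ?thesis
    by (intro AE_eq_0 lower_integral_eq_0_of_bridge[OF assms(1)])
qed

end
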